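(* Let $(u,v)\in\overline{P}$. Then $$\widetilde{m}\left(((uv)^T)^\infty\right)=\widetilde{m}\left(2u^+(uv)^\infty\right)=\widetilde{m}\left(v^T((uv)^T)^\infty\right)=\widetilde{m}\left(2u^+v(uv)^\infty\right),$$ and this common value equals $\frac{3+m\left((uv)^\infty\right)}{2}$, where $m((uv)^\infty)$ is the Markov value of the bi-infinite periodic sequence $(uv)^\infty=\cdots uvuvuv\cdots$.
   Context: The letters $a$ and $b$ denote the two-digit blocks $a=22$, $b=11$; words over $\{a,b\}$ are identified with words over $\{1,2\}$, and a prefixed "$2$" denotes the single digit $2$. For a finite word $w$ over $\{a,b\}$: $w^T$ is its reversal, $w^+$ is $w$ with its first letter from $\{a,b\}$ removed, $w^\infty=www\cdots$. $\overline{P}$ is the set of pairs of words obtained from $(a,b)$ by finitely many (possibly zero) applications of the maps $(\alpha,\beta)\mapsto(\alpha\beta,\beta)$ and $(\alpha,\beta)\mapsto(\alpha,\alpha\beta)$. For an irrational $x=[x_0;x_1,x_2,\dots]$ (continued fraction), $\widetilde{m}(x)=\inf\{c>0:\left|x-\frac{p}{q}\right|<\frac{1}{cq^2}\text{ has no rational solution }\frac pq\}$, which equals $\sup_{n\geq1}\left([x_n;x_{n+1},\dots]+[0;x_{n-1},\dots,x_1]\right)$. For a right infinite word $w=w_1w_2\dots$ over $\{1,2\}$, $\widetilde{m}(w)$ means $\widetilde{m}([0;w_1,w_2,\dots])$. For a bi-infinite sequence $(y_i)_{i\in\mathbb{Z}}$ of positive integers, its Markov value is $m((y_i))=\sup_{i\in\mathbb{Z}}\left([y_i;y_{i+1},y_{i+2},\dots]+[0;y_{i-1},y_{i-2},\dots]\right)$.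 *)

theory Defs
  imports "HOL-Analysis.Analysis" "HOL-Library.Omega_Words_Fun"
begin

datatype letter = A | B

fun block :: "letter \<Rightarrow> nat list" where
  "block A = [2, 2]"
| "block B = [1, 1]"

definition digits :: "letter list \<Rightarrow> nat list" where
  "digits w = concat (map block w)"

inductive_set Pbar :: "(letter list \<times> letter list) set" where
  base: "([A], [B]) \<in> Pbar"
| left: "(\<alpha>, \<beta>) \<in> Pbar \<Longrightarrow> (\<alpha> @ \<beta>, \<beta>) \<in> Pbar"
| right: "(\<alpha>, \<beta>) \<in> Pbar \<Longrightarrow> (\<alpha>, \<alpha> @ \<beta>) \<in> Pbar"

fun convergent_value :: "(nat \<Rightarrow> nat) \<Rightarrow> nat \<Rightarrow> real" where
  "convergent_value x 0 = real (x 0)"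
| "convergent_value x (Suc n) = real (x 0) + 1 / convergent_value (suffix 1 x) n"

definition cfrac :: "(nat \<Rightarrow> nat) \<Rightarrow> real" where
  "cfrac x = lim (convergent_value x)"

text \<open>The infimum and the supremum below are taken in the extended reals, so that the value is
  \<open>\<infinity>\<close> (and not an unspecified real) in the unbounded case.\<close>

definition mtilde :: "real \<Rightarrow> ereal" where
  "mtilde x = Inf (ereal ` {c. c > 0 \<and>
     \<not> (\<exists>p q :: int. q > 0 \<and> \<bar>x - of_int p / of_int q\<bar> < 1 / (c * (of_int q)\<^sup>2))})"

definition mtilde_word :: "(nat \<Rightarrow> nat) \<Rightarrow> ereal" where
  "mtilde_word w = mtilde (cfrac (0 ## w))"

definition markov_value :: "(int \<Rightarrow> nat) \<Rightarrow> ereal" where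
  "markov_value y = (SUP i. ereal
     (cfrac (\<lambda>k. y (i + int k)) + cfrac (0 ## (\<lambda>k. y (i - 1 - int k)))))"

definition bi_iter :: "'a list \<Rightarrow> int \<Rightarrow> 'a" where
  "bi_iter w i = w ! nat (i mod int (length w))"

end

theory Submission
  imports Defs
begin

text \<open>
  Call a place where a continued fraction is split a cut; the approximation constant is the largest
  cut value. Inside \<open>L a b R\<close>, the cut between the two digits of \<open>a\<close> has value
  \<open>3 + 1 / (2 + l) - 1 / (2 + r)\<close>, where \<open>l\<close> and \<open>r\<close> are the values \<open>[0; \<dots>]\<close> of the reversal of
  \<open>L\<close> and of \<open>R\<close>; \<open>L b a R\<close> is the mirror image, and all other cuts are too small to matter.
  The words \<open>u\<close>, \<open>v\<close> are images of \<open>a\<close>, \<open>b\<close> under substitutions that preserve the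
  lexicographic order, so the extremal \<open>L\<close> and \<open>R\<close> can be followed through the substitutions.

  One has \<open>uv = a\<pi>b\<close> with a palindrome \<open>\<pi>\<close>. The two-sided maximum is
  \<open>m = 3 + \<beta> - \<alpha>\<close>, where \<open>\<alpha>\<close> and \<open>\<beta>\<close> are \<open>1 / (2 + \<cdot>)\<close> of the values of
  \<open>(\<pi>ab)\<^sup>\<omega>\<close> and \<open>(\<pi>ba)\<^sup>\<omega>\<close>. The four one-sided words are
  \<open>b(\<pi>ab)\<^sup>\<omega>\<close> and \<open>b(\<pi>ba)\<^sup>\<omega>\<close>, each with its initial \<open>b = 11\<close> possibly written as \<open>2\<close>,
  and their best cut replaces \<open>\<beta>\<close> (respectively \<open>\<alpha>\<close>) by \<open>\<gamma>\<close>, obtained from the finite word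
  \<open>\<pi>b\<close>. As the matrix of \<open>\<pi>\<close> is symmetric, \<open>\<alpha>\<close> and \<open>3 + \<beta>\<close> are roots of one quadratic
  polynomial, which gives \<open>2\<gamma> = \<alpha> + \<beta>\<close> and hence the value \<open>(3 + m) / 2\<close>.
\<close>

section \<open>Continued fractions and the approximation constant\<close>

lemma convergent_value_ge_1:
  assumes "\<forall>k. x k \<ge> 1"
  shows "convergent_value x n \<ge> 1"
  using assms
proof (induction n arbitrary: x)
  case 0
  then show ?case by auto
next
  case (Suc n)
  have "convergent_value (suffix 1 x) n \<ge> 1"
    using Suc.IH[of "suffix 1 x"] Suc.prems suffix_nth[of 1 x] by metis
  then have "1 / convergent_value (suffix 1 x) n \<ge> 0" by simp
  moreover have "real (x 0) \<ge> 1"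
    using of_nat_mono[of 1 "x 0"] Suc.prems by simp
  ultimately show ?case unfolding convergent_value.simps by linarith
qed

text \<open>One step of the recursion need not contract near 1, but two do: the derivative of 1 / (b
  + 1 / z) in z is 1 / (b z + 1)^2, at most 1/4 for b, z \<ge> 1.\<close>

lemma convergent_value_two_steps:
  assumes "\<forall>k. x k \<ge> 1"
  shows "\<bar>convergent_value x (n + 2) - convergent_value x (m + 2)\<bar>
           \<le> \<bar>convergent_value (suffix 2 x) n - convergent_value (suffix 2 x) m\<bar> / 4"
proof -
  define b c d where "b = real (x 1)" and "c = convergent_value (suffix 2 x) n"
    and "d = convergent_value (suffix 2 x) m"
  have b: "b \<ge> 1" using of_nat_mono[of 1 "x 1"] assms by (simp add: b_def)
  have c: "c \<ge> 1" and d: "d \<ge> 1"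
    using assms by (auto simp: c_def d_def intro: convergent_value_ge_1)
  have s: "suffix (Suc 0) (suffix (Suc 0) x) = suffix 2 x"
    by (simp add: numeral_2_eq_2)
  have bc: "b * c \<ge> 1" "b * d \<ge> 1"
    using mult_mono[OF b c] mult_mono[OF b d] b by auto
  have e: "1 / (b + 1 / z) = z / (b * z + 1)" if "z > 0" for z
    using that b by (simp add: field_simps)
  have "1 / (b + 1 / c) - 1 / (b + 1 / d) = (c - d) / ((b * c + 1) * (b * d + 1))"
  proof -
    have "b * c + 1 \<noteq> 0" "b * d + 1 \<noteq> 0" using bc by linarith+
    then show ?thesis using c d by (simp add: e field_simps)
  qed
  then have "\<bar>1 / (b + 1 / c) - 1 / (b + 1 / d)\<bar> = \<bar>c - d\<bar> / ((b * c + 1) * (b * d + 1))"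
    using bc by (simp add: abs_mult)
  also have "\<dots> \<le> \<bar>c - d\<bar> / 4"
  proof (rule divide_left_mono)
    show "4 \<le> (b * c + 1) * (b * d + 1)"
      using mult_mono[of 2 "b * c + 1" 2 "b * d + 1"] bc by simp
    then show "0 < (b * c + 1) * (b * d + 1) * 4" by simp
  qed simp
  finally show ?thesis
    by (simp add: b_def c_def d_def s numeral_2_eq_2)
qed

lemma convergent_value_diff_le:
  assumes "\<forall>k. x k \<ge> 1" "n \<le> m"
  shows "\<bar>convergent_value x n - convergent_value x m\<bar> \<le> 2 * (1 / 2) ^ n"
  using assms
proof (induction n arbitrary: x m rule: induct_nat_012)
  case 0
  show ?case
  proof (cases m)
    case (Suc k)
    have "convergent_value (suffix 1 x) k \<ge> 1"
      using 0 by (intro convergent_value_ge_1) auto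
    then have "0 \<le> 1 / convergent_value (suffix 1 x) k" "1 / convergent_value (suffix 1 x) k \<le> 1"
      by auto
    then show ?thesis using Suc by simp
  qed simp
next
  case 1
  then obtain k where k: "m = Suc k" by (cases m) auto
  have a: "convergent_value (suffix 1 x) j \<ge> 1" for j
    using 1 by (intro convergent_value_ge_1) auto
  have "0 \<le> 1 / convergent_value (suffix 1 x) j" "1 / convergent_value (suffix 1 x) j \<le> 1" for j
    using a[of j] by auto
  from this[of 0] this[of k]
  have "\<bar>1 / convergent_value (suffix 1 x) 0 - 1 / convergent_value (suffix 1 x) k\<bar> \<le> 1"
    by linarith
  then show ?case using k by simp
next
  case (ge2 n)
  then obtain k where k: "m = k + 2" by (metis add.commute le_Suc_ex add_2_eq_Suc' add_Suc_right group_cancel.add2)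
  have "\<bar>convergent_value (suffix 2 x) n - convergent_value (suffix 2 x) k\<bar> \<le> 2 * (1 / 2) ^ n"
    using ge2 k by (intro ge2.IH) auto
  then show ?case
    using convergent_value_two_steps[of x n k] ge2.prems k by simp
qed

lemma convergent_convergent_value:
  assumes "\<forall>k. x k \<ge> 1"
  shows "convergent (convergent_value x)"
proof (rule Cauchy_convergent, rule metric_CauchyI)
  fix e :: real assume e: "e > 0"
  obtain N where N: "(1 / 2) ^ N < e / 4"
    using real_arch_pow_inv[of "e / 4" "1 / 2"] e by auto
  have D: "\<bar>convergent_value x N - convergent_value x m\<bar> < e / 2" if "m \<ge> N" for m
    using convergent_value_diff_le[OF assms that] N by simp
  have "dist (convergent_value x m) (convergent_value x n) < e" if "m \<ge> N" "n \<ge> N" for m n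
    using D[OF that(1)] D[OF that(2)] unfolding dist_real_def by linarith
  then show "\<exists>M. \<forall>m\<ge>M. \<forall>n\<ge>M. dist (convergent_value x m) (convergent_value x n) < e"
    by blast
qed

lemma convergent_value_LIMSEQ:
  assumes "\<forall>k. x k \<ge> 1"
  shows "convergent_value x \<longlonglongrightarrow> cfrac x"
  using convergent_convergent_value[OF assms] by (simp add: cfrac_def convergent_LIMSEQ_iff)

lemma cfrac_ge_1:
  assumes "\<forall>k. x k \<ge> 1"
  shows "cfrac x \<ge> 1"
  using convergent_value_LIMSEQ[OF assms]
  by (rule LIMSEQ_le_const) (use convergent_value_ge_1[OF assms] in auto)

lemma cfrac_rec:
  assumes "\<And>k. k \<ge> 1 \<Longrightarrow> x k \<ge> 1"
  shows "cfrac x = real (x 0) + 1 / cfrac (suffix 1 x)"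
proof -
  have s: "\<forall>k. suffix 1 x k \<ge> 1" using assms by simp
  have "(\<lambda>n. real (x 0) + 1 / convergent_value (suffix 1 x) n)
          \<longlonglongrightarrow> real (x 0) + 1 / cfrac (suffix 1 x)"
    using cfrac_ge_1[of "suffix 1 x", OF s]
    by (intro tendsto_intros convergent_value_LIMSEQ s) linarith
  then have "(\<lambda>n. convergent_value x (Suc n)) \<longlonglongrightarrow> real (x 0) + 1 / cfrac (suffix 1 x)"
    by simp
  then have "convergent_value x \<longlonglongrightarrow> real (x 0) + 1 / cfrac (suffix 1 x)"
    by (rule LIMSEQ_imp_Suc)
  then show ?thesis by (simp add: cfrac_def limI)
qed

lemma cfrac_0_build:
  assumes "\<forall>k. x k \<ge> 1"
  shows "cfrac (0 ## x) = 1 / cfrac x"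
proof -
  have "(0 ## x) k \<ge> 1" if "k \<ge> 1" for k
    using that assms by (cases k) auto
  moreover have "suffix 1 (0 ## x) = x" by (simp add: fun_eq_iff)
  ultimately show ?thesis using cfrac_rec[of "0 ## x"] by simp
qed

section \<open>Convergents, their errors and best approximation\<close>

fun denom :: "(nat \<Rightarrow> nat) \<Rightarrow> nat \<Rightarrow> nat" where
  "denom w 0 = 0"
| "denom w (Suc 0) = 1"
| "denom w (Suc (Suc n)) = w n * denom w (Suc n) + denom w n"

fun numer :: "(nat \<Rightarrow> nat) \<Rightarrow> nat \<Rightarrow> nat" where
  "numer w 0 = 1"
| "numer w (Suc 0) = 0"
| "numer w (Suc (Suc n)) = w n * numer w (Suc n) + numer w n"

fun backward :: "(nat \<Rightarrow> nat) \<Rightarrow> nat \<Rightarrow> real" where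
  "backward w 0 = 0"
| "backward w (Suc n) = 1 / (real (w n) + backward w n)"

text \<open>\<open>backward w n\<close> is \<open>[0; w (n - 1), \<dots>, w 0]\<close>, so \<open>cut w n\<close> is the sum
  \<open>[x\<^sub>k; x\<^sub>k\<^sub>+\<^sub>1, \<dots>] + [0; x\<^sub>k\<^sub>-\<^sub>1, \<dots>, x\<^sub>1]\<close> with \<open>k = n + 1\<close> and
  \<open>x\<^sub>i = w (i - 1)\<close>.
  The indices of \<open>denom\<close> and \<open>numer\<close> are shifted by one: index \<open>0\<close> is the formal convergent
  \<open>1 / 0\<close>.\<close>

definition cut :: "(nat \<Rightarrow> nat) \<Rightarrow> nat \<Rightarrow> real" where
  "cut w n = cfrac (suffix n w) + backward w n"

lemma denom_pos:
  assumes "\<forall>k. w k \<ge> 1"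
  shows "denom w (Suc n) \<ge> 1"
proof (induction n rule: induct_nat_012)
  case (ge2 n)
  then have "1 * 1 \<le> w (Suc n) * denom w (Suc (Suc n))"
    using spec[OF assms, of "Suc n"] by (intro mult_le_mono)
  then show ?case unfolding denom.simps(3)[of w "Suc n"] by linarith
qed (use spec[OF assms, of 0] in auto)

lemma denom_ge:
  assumes "\<forall>k. w k \<ge> 1"
  shows "denom w (n + 2) \<ge> n"
proof (induction n)
  case (Suc n)
  have "denom w (Suc (Suc (Suc n))) \<ge> denom w (Suc (Suc n)) + denom w (Suc n)"
    unfolding denom.simps(3)[of w "Suc n"] using spec[OF assms, of "Suc n"] by (intro add_mono) auto
  then show ?case using Suc denom_pos[OF assms, where n = n]
    unfolding add_2_eq_Suc' by linarith
qed simp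

lemma back_eq_denom:
  assumes "\<forall>k. w k \<ge> 1"
  shows "backward w n = denom w n / denom w (Suc n)"
proof (induction n)
  case (Suc n)
  have q: "real (denom w (Suc n)) > 0" using denom_pos[OF assms, of n] by simp
  have "real (w n) + backward w n = denom w (Suc (Suc n)) / denom w (Suc n)"
    unfolding Suc using q by (simp add: field_simps)
  then show ?case by simp
qed simp

lemma denom_numer_det:
  "int (denom w (Suc n)) * int (numer w n) - int (denom w n) * int (numer w (Suc n)) = (-1) ^ n"
  by (induction n) (auto simp: algebra_simps)

lemma abs_le_abs_add:
  fixes a b :: real
  assumes "a * b > 0"
  shows "\<bar>a\<bar> \<le> \<bar>a + b\<bar>"
proof -
  consider "a > 0" "b > 0" | "a < 0" "b < 0" using assms by (metis zero_less_mult_iff)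
  then show ?thesis by cases auto
qed

context
  fixes w :: "nat \<Rightarrow> nat" and x :: real
  assumes w: "\<forall>k. w k \<ge> 1"
    and x: "x = cfrac (0 ## w)"
begin

definition err :: "nat \<Rightarrow> real" where
  "err n = denom w n * x - numer w n"

lemma tail_ge_1: "cfrac (suffix n w) \<ge> 1"
  using w by (intro cfrac_ge_1) simp

lemma tail_rec: "cfrac (suffix n w) = w n + 1 / cfrac (suffix (Suc n) w)"
  using w cfrac_rec[of "suffix n w"] by simp

text \<open>This is x = (p t + p') / (q t + q') with the complete quotient t, cleared of
  denominators.\<close>

lemma err_step: "err n = - cfrac (suffix n w) * err (Suc n)"
proof (induction n)
  case 0
  have "x * cfrac w = 1" using x cfrac_0_build[OF w] tail_ge_1[of 0] by simp
  then show ?case by (simp add: err_def mult.commute)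
next
  case (Suc n)
  have "err (Suc (Suc n)) = w n * err (Suc n) + err n"
    by (simp add: err_def algebra_simps)
  also have "\<dots> = - err (Suc n) / cfrac (suffix (Suc n) w)"
    unfolding Suc tail_rec[of n] by (simp add: algebra_simps)
  finally show ?case
    using tail_ge_1[of "Suc n"] by (simp del: suffix_nth)
qed

lemma err_nonzero: "err n \<noteq> 0"
proof (induction n)
  case 0
  show ?case by (simp add: err_def)
next
  case (Suc n)
  then show ?case using err_step[of n] by auto
qed

lemma denom_err: "denom w (Suc n) * err n - denom w n * err (Suc n) = - ((-1) ^ n)"
proof -
  have "denom w (Suc n) * err n - denom w n * err (Suc n) =
      - real_of_int (int (denom w (Suc n)) * int (numer w n) - int (denom w n) * int (numer w (Suc n)))"
    by (simp add: err_def algebra_simps)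
  then show ?thesis unfolding denom_numer_det by simp
qed

text \<open>Perron's formula: for a convergent, q |q x - p| is the reciprocal of its cut. Inserting
  \<open>err_step\<close> into the determinant identity leaves the factor q t + q', which is q times
  the cut.\<close>

lemma abs_err: "\<bar>err (Suc n)\<bar> * denom w (Suc n) * cut w n = 1"
proof -
  have q: "real (denom w (Suc n)) > 0" using denom_pos[OF w, of n] by simp
  have c: "denom w (Suc n) * cut w n = denom w (Suc n) * cfrac (suffix n w) + denom w n"
    using q by (simp add: cut_def back_eq_denom[OF w] field_simps)
  have "err (Suc n) * (denom w (Suc n) * cfrac (suffix n w) + denom w n) = (-1) ^ n"
    using denom_err[of n] unfolding err_step[of n] by (simp add: algebra_simps)
  then have "\<bar>err (Suc n)\<bar> * \<bar>denom w (Suc n) * cfrac (suffix n w) + denom w n\<bar> = 1"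
    by (metis abs_mult power_abs abs_minus_cancel abs_one power_one)
  moreover have "denom w (Suc n) * cfrac (suffix n w) + denom w n \<ge> 0"
    using tail_ge_1[of n] by simp
  ultimately show ?thesis using c by (simp add: mult.assoc)
qed

lemma err_opposite: "err n * err (Suc n) < 0"
proof -
  have "err n * err (Suc n) = - (cfrac (suffix n w) * (err (Suc n))\<^sup>2)"
    unfolding err_step[of n] by (simp add: power2_eq_square)
  then show ?thesis using tail_ge_1[of n] err_nonzero[of "Suc n"] by simp
qed

text \<open>Lagrange's law of best approximation. In the basis of two consecutive convergents, (p,
  q) has coefficients of opposite sign because 0 < q < Q'. The errors alternate in sign too, so the
  two contributions to q x - p reinforce each other.\<close>

lemma best_approximation:
  fixes p q :: int
  assumes q: "q > 0" "q < denom w (Suc (Suc n))"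
    and ne: "q * numer w (Suc n) \<noteq> p * denom w (Suc n)"
  shows "\<bar>err (Suc n)\<bar> \<le> \<bar>q * x - p\<bar>"
proof -
  define Q P Q' P' where "Q = int (denom w (Suc n))" and "P = int (numer w (Suc n))"
    and "Q' = int (denom w (Suc (Suc n)))" and "P' = int (numer w (Suc (Suc n)))"
  define s where "s = (-1 :: int) ^ Suc n"
  have det: "Q' * P - Q * P' = s"
    using denom_numer_det[of w "Suc n"] by (simp only: Q_def P_def Q'_def P'_def s_def)
  have ss: "s * s = 1" by (simp add: s_def flip: power_mult_distrib)
  \<comment> \<open>Cramer's rule; the determinant \<open>s\<close> is 1 or -1, hence its own
    inverse.\<close>
  define i j where "i = s * (Q' * p - P' * q)" and "j = s * (P * q - Q * p)"
  have iq: "i * Q + j * Q' = q"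
  proof -
    have "i * Q + j * Q' = s * (Q' * P - Q * P') * q" by (simp add: i_def j_def algebra_simps)
    then show ?thesis using det ss by simp
  qed
  have ip: "i * P + j * P' = p"
  proof -
    have "i * P + j * P' = s * (Q' * P - Q * P') * p" by (simp add: i_def j_def algebra_simps)
    then show ?thesis using det ss by simp
  qed
  have Qpos: "Q > 0" and Qpos': "Q' > 0"
    using denom_pos[OF w, of n] denom_pos[OF w, of "Suc n"] by (simp_all only: Q_def Q'_def)
  have jn: "j \<noteq> 0" using ne ss by (auto simp: j_def Q_def P_def s_def mult.commute)
  have qq: "q < Q'" using q by (simp add: Q'_def)
  have "i \<noteq> 0"
  proof
    assume "i = 0"
    then have "j * Q' = q" using iq by simp
    moreover from this have "j \<ge> 1" using q Qpos' by (metis not_le int_one_le_iff_zero_less zero_less_mult_pos2)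
    ultimately show False using qq Qpos' mult_right_mono[of 1 j Q'] by simp
  qed
  have opp: "i * j < 0"
  proof (rule ccontr)
    assume "\<not> i * j < 0"
    then have "i * j > 0" using jn \<open>i \<noteq> 0\<close> by (metis linorder_neqE_linordered_idom mult_eq_0_iff)
    then consider "i > 0" "j > 0" | "i < 0" "j < 0" by (metis zero_less_mult_iff)
    then show False
    proof cases
      case 1
      then have "i * Q \<ge> 0" "j * Q' \<ge> Q'" using Qpos Qpos' by auto
      then show False using iq qq by linarith
    next
      case 2
      then have "i * Q < 0" "j * Q' < 0" using Qpos Qpos' by (auto simp: mult_neg_pos)
      then show False using iq q by linarith
    qed
  qed
  have E: "q * x - p = i * err (Suc n) + j * err (Suc (Suc n))"
  proof -
    have "q * x - p = of_int (i * Q + j * Q') * x - of_int (i * P + j * P')"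
      using iq ip by simp
    also have "\<dots> = i * (of_int Q * x - of_int P) + j * (of_int Q' * x - of_int P')"
      by (simp add: algebra_simps)
    finally show ?thesis by (simp add: err_def Q_def P_def Q'_def P'_def)
  qed
  have "(i * err (Suc n)) * (j * err (Suc (Suc n))) > 0"
  proof -
    have "real_of_int (i * j) < 0" using opp by (simp only: of_int_less_0_iff)
    then have "real_of_int (i * j) * (err (Suc n) * err (Suc (Suc n))) > 0"
      using err_opposite[of "Suc n"] by (rule mult_neg_neg)
    then show ?thesis by (simp add: ac_simps)
  qed
  then have "\<bar>q * x - p\<bar> \<ge> \<bar>i * err (Suc n)\<bar>"
    unfolding E by (rule abs_le_abs_add)
  moreover have "\<bar>i * err (Suc n)\<bar> \<ge> \<bar>err (Suc n)\<bar>"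
  proof -
    have "\<bar>real_of_int i\<bar> \<ge> 1" using \<open>i \<noteq> 0\<close> by linarith
    then show ?thesis by (simp add: abs_mult mult_le_cancel_right1)
  qed
  ultimately show ?thesis by linarith
qed

text \<open>Choose consecutive denominators with Q \<le> q < Q'. Either p/q is the convergent P/Q,
  and Perron's formula applies, or the nonzero integer q P - p Q forces q |q x - p| \<ge> 1/2, which
  is where \<open>V \<ge> 2\<close> enters.\<close>

lemma approximation_lower_bound:
  fixes p q :: int
  assumes q: "q > 0" and V: "V \<ge> 2" "\<And>n. cut w n \<le> V"
  shows "1 \<le> V * (q * \<bar>q * x - p\<bar>)"
proof -
  have "\<exists>n. q < denom w (Suc (Suc n))"
    using denom_ge[OF w, of "nat q + 1"] unfolding add_2_eq_Suc'
    by (intro exI[of _ "nat q + 1"]) linarith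
  then obtain n where n: "q < denom w (Suc (Suc n))" "\<And>k. k < n \<Longrightarrow> \<not> q < denom w (Suc (Suc k))"
    using exists_least_iff[of "\<lambda>n. q < denom w (Suc (Suc n))"] by blast
  define Q where "Q = denom w (Suc n)"
  have Q: "int Q \<le> q"
  proof (cases n)
    case 0
    then show ?thesis using q by (simp add: Q_def)
  next
    case (Suc k)
    then show ?thesis using n(2)[of k] by (simp add: Q_def)
  qed
  have Q1: "Q \<ge> 1" unfolding Q_def by (rule denom_pos[OF w])
  have qr: "real Q \<le> of_int q" using Q by linarith
  show ?thesis
  proof (cases "q * numer w (Suc n) = p * denom w (Suc n)")
    case True
    have "real Q * \<bar>q * x - p\<bar> = \<bar>q * (Q * x) - real_of_int p * real Q\<bar>"
    proof -
      have "q * (Q * x) - real_of_int p * real Q = Q * (q * x - p)" by (simp add: algebra_simps)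
      then show ?thesis by (simp add: abs_mult)
    qed
    also have "real_of_int p * real Q = real_of_int q * real (numer w (Suc n))"
      using True by (metis Q_def of_int_mult of_int_of_nat_eq)
    also have "\<bar>q * (Q * x) - real_of_int q * real (numer w (Suc n))\<bar> = q * \<bar>err (Suc n)\<bar>"
      using q by (simp add: err_def Q_def abs_mult flip: right_diff_distrib)
    finally have e: "real Q * \<bar>q * x - p\<bar> = q * \<bar>err (Suc n)\<bar>" .
    have "Q * \<bar>err (Suc n)\<bar> \<le> q * \<bar>err (Suc n)\<bar>" using qr by (simp add: mult_right_mono)
    then have "\<bar>err (Suc n)\<bar> \<le> \<bar>q * x - p\<bar>" using Q1 unfolding e[symmetric] by simp
    then have "Q * \<bar>err (Suc n)\<bar> \<le> q * \<bar>q * x - p\<bar>" using qr by (intro mult_mono) auto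
    then have "V * (Q * \<bar>err (Suc n)\<bar>) \<le> V * (q * \<bar>q * x - p\<bar>)" using V by simp
    moreover have "1 \<le> V * (Q * \<bar>err (Suc n)\<bar>)"
      using abs_err[of n] mult_right_mono[OF V(2)[of n], of "Q * \<bar>err (Suc n)\<bar>"]
      by (simp add: Q_def ac_simps)
    ultimately show ?thesis by linarith
  next
    case False
    have b: "\<bar>err (Suc n)\<bar> \<le> \<bar>q * x - p\<bar>"
      by (rule best_approximation[OF q n(1) False])
    have "1 \<le> \<bar>q * numer w (Suc n) - p * denom w (Suc n)\<bar>" using False by linarith
    then have "1 \<le> \<bar>real_of_int (q * numer w (Suc n) - p * denom w (Suc n))\<bar>"
      by (simp only: of_int_abs[symmetric] of_int_1_le_iff)
    also have "real_of_int (q * numer w (Suc n) - p * denom w (Suc n)) = Q * (q * x - p) - q * err (Suc n)"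
      by (simp add: Q_def err_def algebra_simps)
    also have "\<bar>\<dots>\<bar> \<le> Q * \<bar>q * x - p\<bar> + q * \<bar>err (Suc n)\<bar>"
      using q by (intro abs_triangle_ineq4[THEN order_trans]) (simp add: abs_mult)
    also have "\<dots> \<le> q * \<bar>q * x - p\<bar> + q * \<bar>q * x - p\<bar>"
      using b qr q by (intro add_mono mult_mono) auto
    also have "\<dots> \<le> V * (q * \<bar>q * x - p\<bar>)"
      using V(1) q mult_right_mono[of 2 V "q * \<bar>q * x - p\<bar>"] by simp
    finally show ?thesis .
  qed
qed

text \<open>\<open>V\<close> is admissible by the lower bound just proved. The convergent belonging
  to the attained cut \<open>k\<close> has q |q x - p| = 1 / V, which excludes every smaller
  constant.\<close>

lemma mtilde_eqI:
  assumes V: "V \<ge> 2" "\<And>n. cut w n \<le> V" and k: "cut w k = V"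
  shows "mtilde x = ereal V"
proof -
  let ?S = "{c. c > 0 \<and>
     \<not> (\<exists>p q :: int. q > 0 \<and> \<bar>x - of_int p / of_int q\<bar> < 1 / (c * (of_int q)\<^sup>2))}"
  have iff: "\<bar>x - of_int p / of_int q\<bar> < 1 / (c * (of_int q)\<^sup>2) \<longleftrightarrow> c * (q * \<bar>q * x - p\<bar>) < 1"
    if "q > 0" "c > 0" for p q :: int and c :: real
  proof -
    have "\<bar>q * x - p\<bar> = q * \<bar>x - of_int p / of_int q\<bar>"
      using that by (simp add: abs_mult_pos' field_simps)
    then show ?thesis using that by (simp add: field_simps power2_eq_square)
  qed
  have "V \<in> ?S"
  proof -
    have "V > 0" using V(1) by simp
    moreover have "\<not> \<bar>x - of_int p / of_int q\<bar> < 1 / (V * (of_int q)\<^sup>2)" if "q > 0" for p q :: int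
      using approximation_lower_bound[OF that V, where p = p] iff[OF that \<open>V > 0\<close>, of p] by linarith
    ultimately show ?thesis by blast
  qed
  moreover have "V \<le> c" if c: "c \<in> ?S" for c
  proof -
    have q: "int (denom w (Suc k)) > 0" using denom_pos[OF w, of k] by simp
    have "1 \<le> c * (denom w (Suc k) * \<bar>err (Suc k)\<bar>)"
    proof -
      have "c > 0" and "\<not> \<bar>x - of_int (int (numer w (Suc k))) / of_int (int (denom w (Suc k)))\<bar>
          < 1 / (c * (of_int (int (denom w (Suc k))))\<^sup>2)"
        using c q by blast+
      then show ?thesis using iff[OF q, of c "int (numer w (Suc k))"] by (simp add: err_def)
    qed
    also have "denom w (Suc k) * \<bar>err (Suc k)\<bar> = 1 / V"
      using abs_err[of k] V(1) k by (simp add: field_simps)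
    finally show ?thesis using V(1) by (simp add: field_simps)
  qed
  ultimately show ?thesis
    unfolding mtilde_def by (intro antisym Inf_lower Inf_greatest) auto
qed

end

lemma mtilde_word_eqI:
  assumes "\<forall>k. w k \<ge> 1" "V \<ge> 2" "\<And>n. cut w n \<le> V" "cut w k = V"
  shows "mtilde_word w = ereal V"
  unfolding mtilde_word_def by (rule mtilde_eqI[OF assms(1) refl assms(2-)])

section \<open>The order of blocks and substitutions\<close>

definition subst :: "letter list \<Rightarrow> letter list \<Rightarrow> letter list \<Rightarrow> letter list" where
  "subst p q w = concat (map (\<lambda>c. case c of A \<Rightarrow> p | B \<Rightarrow> q) w)"

lemma subst_simps [simp]:
  "subst p q [] = []"
  "subst p q (A # w) = p @ subst p q w"
  "subst p q (B # w) = q @ subst p q w"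
  "subst p q (w @ w') = subst p q w @ subst p q w'"
  by (simp_all add: subst_def)

lemma subst_subst: "subst p q (subst u v w) = subst (subst p q u) (subst p q v) w"
proof (induction w)
  case (Cons c w)
  then show ?case by (cases c) auto
qed simp

lemma rev_subst: "rev (subst p q w) = subst (rev p) (rev q) (rev w)"
proof (induction w)
  case (Cons c w)
  then show ?case by (cases c) auto
qed simp

abbreviation phi1 :: "letter list \<Rightarrow> letter list" where
  "phi1 \<equiv> subst [A, B] [B]"

abbreviation phi2 :: "letter list \<Rightarrow> letter list" where
  "phi2 \<equiv> subst [A] [A, B]"

text \<open>The substitution and its letterwise reversal are conjugate by b; this keeps palindromes
  palindromic.\<close>

lemma phi1_commute: "B # phi1 w = subst [B, A] [B] w @ [B]"
proof (induction w)
  case (Cons c w)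
  then show ?case by (cases c) auto
qed simp

lemma phi2_commute: "phi2 w @ [A] = A # subst [A] [B, A] w"
proof (induction w)
  case (Cons c w)
  then show ?case by (cases c) auto
qed simp

text \<open>\<open>Pbar\<close> extends words on the inside (\<open>\<sigma> \<mapsto> \<sigma> \<circ> \<phi>\<close>), whereas the order arguments below
  apply a substitution to a finished word (\<open>\<sigma> \<mapsto> \<phi> \<circ> \<sigma>\<close>).\<close>

inductive_set Pout :: "(letter list \<times> letter list) set" where
  base: "([A], [B]) \<in> Pout"
| phi1: "(u, v) \<in> Pout \<Longrightarrow> (phi1 u, phi1 v) \<in> Pout"
| phi2: "(u, v) \<in> Pout \<Longrightarrow> (phi2 u, phi2 v) \<in> Pout"

text \<open>Outer substitutions are morphisms and so commute with inner concatenation; only the base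
  pair needs a check, where the inner extension is itself an outer \<open>phi1\<close>.\<close>

lemma Pout_left: "(u, v) \<in> Pout \<Longrightarrow> (u @ v, v) \<in> Pout"
proof (induction rule: Pout.induct)
  case base
  show ?case using Pout.phi1[OF Pout.base] by simp
next
  case (phi1 u v)
  from Pout.phi1[OF phi1.IH] show ?case by simp
next
  case (phi2 u v)
  from Pout.phi2[OF phi2.IH] show ?case by simp
qed

lemma Pout_right: "(u, v) \<in> Pout \<Longrightarrow> (u, u @ v) \<in> Pout"
proof (induction rule: Pout.induct)
  case base
  show ?case using Pout.phi2[OF Pout.base] by simp
next
  case (phi1 u v)
  from Pout.phi1[OF phi1.IH] show ?case by simp
next
  case (phi2 u v)
  from Pout.phi2[OF phi2.IH] show ?case by simp
qed

lemma Pbar_imp_Pout: "(u, v) \<in> Pbar \<Longrightarrow> (u, v) \<in> Pout"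
  by (induction rule: Pbar.induct) (auto intro: Pout.base Pout_left Pout_right)

text \<open>The b that \<open>phi1\<close> puts after each a joins the front of \<pi> and
  \<open>x\<close>; the a that \<open>phi2\<close> puts before each b joins the end of \<pi> and
  \<open>z\<close>. The last two equations say that \<open>x\<close> conjugates uv to \<pi>ab and,
  after reversal, that \<open>z\<close> conjugates the reversal of uv to \<pi>ba.\<close>

lemma Pout_central_word:
  assumes "(u, v) \<in> Pout"
  shows "\<exists>\<pi> x z. rev \<pi> = \<pi> \<and> u = A # x \<and> v = z @ [B] \<and> u @ v = A # \<pi> @ [B]
    \<and> x @ u @ v = \<pi> @ [A, B] @ x \<and> (u @ v) @ z = z @ [A, B] @ \<pi>"
  using assms
proof (induction rule: Pout.induct)
  case base
  show ?case by (intro exI[of _ "[]"]) simp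
next
  case (phi1 u v)
  then obtain \<pi> x z where *: "rev \<pi> = \<pi>" "u = A # x" "v = z @ [B]" "u @ v = A # \<pi> @ [B]"
    "x @ u @ v = \<pi> @ [A, B] @ x" "(u @ v) @ z = z @ [A, B] @ \<pi>" by blast
  let ?\<pi> = "B # phi1 \<pi>" and ?x = "B # phi1 x" and ?z = "phi1 z"
  have "rev ?\<pi> = ?\<pi>" using *(1) by (simp add: rev_subst flip: phi1_commute)
  moreover have "phi1 u = A # ?x" "phi1 v = ?z @ [B]" using * by simp_all
  moreover have "phi1 u @ phi1 v = A # ?\<pi> @ [B]"
    using arg_cong[OF *(4), of phi1] by simp
  moreover have "?x @ phi1 u @ phi1 v = ?\<pi> @ [A, B] @ ?x"
    using arg_cong[OF *(5), of phi1] by simp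
  moreover have "(phi1 u @ phi1 v) @ ?z = ?z @ [A, B] @ ?\<pi>"
    using arg_cong[OF *(6), of phi1] by simp
  ultimately show ?case by blast
next
  case (phi2 u v)
  then obtain \<pi> x z where *: "rev \<pi> = \<pi>" "u = A # x" "v = z @ [B]" "u @ v = A # \<pi> @ [B]"
    "x @ u @ v = \<pi> @ [A, B] @ x" "(u @ v) @ z = z @ [A, B] @ \<pi>" by blast
  let ?\<pi> = "phi2 \<pi> @ [A]" and ?x = "phi2 x" and ?z = "phi2 z @ [A]"
  have "rev ?\<pi> = ?\<pi>" using *(1) phi2_commute[of \<pi>] by (simp add: rev_subst)
  moreover have "phi2 u = A # ?x" "phi2 v = ?z @ [B]" using * by simp_all
  moreover have "phi2 u @ phi2 v = A # ?\<pi> @ [B]"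
    using arg_cong[OF *(4), of phi2] by simp
  moreover have "?x @ phi2 u @ phi2 v = ?\<pi> @ [A, B] @ ?x"
    using arg_cong[OF *(5), of phi2] by simp
  moreover have "(phi2 u @ phi2 v) @ ?z = ?z @ [A, B] @ ?\<pi>"
    using arg_cong[OF *(6), of phi2] by simp
  ultimately show ?case by blast
qed

section \<open>Lexicographic order and extremal continuations\<close>

text \<open>The lexicographic order with \<open>B < A\<close> in which the end of a word is larger than every
  letter: the end of a continued fraction stands for a partial quotient \<open>\<infinity>\<close>.\<close>

fun lexle :: "letter list \<Rightarrow> letter list \<Rightarrow> bool" where
  "lexle xs [] = True"
| "lexle [] (y # ys) = False"
| "lexle (x # xs) (y # ys) = (if x = y then lexle xs ys else x = B)"

lemma lexle_refl [simp]: "lexle xs xs"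
  by (induction xs) auto

lemma lexle_trans: "lexle xs ys \<Longrightarrow> lexle ys zs \<Longrightarrow> lexle xs zs"
proof (induction xs ys arbitrary: zs rule: lexle.induct)
  case (1 xs)
  then show ?case by (cases zs) auto
next
  case (3 x xs y ys)
  then show ?case by (cases zs) (auto split: if_splits)
qed simp

lemma lexle_B_Cons: "lexle (B # xs) xs"
proof (induction xs)
  case (Cons c xs)
  then show ?case by (cases c) auto
qed simp

lemma lexle_phi1:
  assumes "lexle xs ys"
  shows "lexle (phi1 xs) (phi1 ys)"
  using assms
proof (induction xs ys rule: lexle.induct)
  case (3 x xs y ys)
  then show ?case by (cases x; cases y) auto
qed auto

lemma hd_phi2: "phi2 xs = [] \<or> (\<exists>ys. phi2 xs = A # ys)"
proof (cases xs)
  case (Cons c ys)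
  then show ?thesis by (cases c) auto
qed simp

lemma lexle_B_phi2: "lexle (B # xs) (phi2 ys)"
  using hd_phi2[of ys] by auto

text \<open>Both letter images begin with a, so b against a is decided one letter later, where b
  meets the end or the a that starts every nonempty image.\<close>

lemma lexle_phi2:
  assumes "lexle xs ys"
  shows "lexle (phi2 xs) (phi2 ys)"
  using assms
proof (induction xs ys rule: lexle.induct)
  case (3 x xs y ys)
  then show ?case by (cases x; cases y) (auto simp: lexle_B_phi2)
qed auto

text \<open>\<open>P\<close> will be a lower bound for continuations after b, or an upper bound
  after a. As lexicographically smaller words have larger values, these give the largest
  \<open>r\<close> and the smallest \<open>l\<close> in the cut formula.\<close>

definition followed :: "letter \<Rightarrow> (letter list \<Rightarrow> bool) \<Rightarrow> letter list \<Rightarrow> bool" where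
  "followed c P V \<longleftrightarrow> (\<forall>L R. V = L @ c # R \<longrightarrow> P R)"

lemma followed_simps [simp]:
  "followed c P []"
  "followed c P (d # V) \<longleftrightarrow> (c = d \<longrightarrow> P V) \<and> followed c P V"
proof -
  show "followed c P []" by (simp add: followed_def)
  show "followed c P (d # V) \<longleftrightarrow> (c = d \<longrightarrow> P V) \<and> followed c P V"
  proof
    assume *: "followed c P (d # V)"
    have "P V" if "c = d" using * that unfolding followed_def by (metis append_Nil)
    moreover have "followed c P V" using * unfolding followed_def by (metis append_Cons)
    ultimately show "(c = d \<longrightarrow> P V) \<and> followed c P V" by simp
  next
    assume *: "(c = d \<longrightarrow> P V) \<and> followed c P V"
    show "followed c P (d # V)"
      unfolding followed_def
    proof (intro allI impI)
      fix L R assume "d # V = L @ c # R"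
      then show "P R" using * by (cases L) (auto simp: followed_def)
    qed
  qed
qed

text \<open>A b may stem from the image of an a, after which nothing is assumed. What follows it is
  then empty, starts with a, or is b followed by a word obeying the bound; hence the extra b in the
  new bound.\<close>

lemma followed_B_phi1:
  assumes "followed B (lexle Q) V"
  shows "followed B (lexle (B # phi1 Q)) (phi1 V)"
  using assms
proof (induction V)
  case (Cons c V)
  have "lexle (B # phi1 Q) (phi1 V)"
  proof (cases c)
    case A
    show ?thesis
    proof (cases V)
      case (Cons d W)
      then show ?thesis using Cons.prems A by (cases d) (auto intro: lexle_phi1)
    qed simp
  next
    case B
    then have "lexle (phi1 Q) (phi1 V)" using Cons.prems by (auto intro: lexle_phi1)
    then show ?thesis using lexle_B_Cons lexle_trans by blast
  qed
  then show ?case using Cons by (cases c) auto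
qed simp

lemma followed_B_phi2:
  assumes "followed B (lexle Q) V"
  shows "followed B (lexle (phi2 Q)) (phi2 V)"
  using assms
proof (induction V)
  case (Cons c V)
  then show ?case by (cases c) (auto intro: lexle_phi2)
qed simp

lemma followed_A_phi1:
  assumes "followed A (\<lambda>R. lexle R P) V"
  shows "followed A (\<lambda>R. lexle R (B # phi1 P)) (phi1 V)"
  using assms
proof (induction V)
  case (Cons c V)
  then show ?case by (cases c) (auto intro: lexle_phi1)
qed simp

text \<open>An a stemming from the image of b is followed by b, and that is below
  \<open>phi2 P\<close>, which is empty or starts with a.\<close>

lemma followed_A_phi2:
  assumes "followed A (\<lambda>R. lexle R P) V"
  shows "followed A (\<lambda>R. lexle R (phi2 P)) (phi2 V)"
  using assms
proof (induction V)
  case (Cons c V)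
  then show ?case by (cases c) (auto intro: lexle_phi2 lexle_B_phi2)
qed simp

text \<open>Each outer substitution changes the bound exactly as it changes
  \<open>tl u @ subst u v Q\<close>: the b added by \<open>phi1\<close> is the second letter of
  \<open>phi1 u\<close>.\<close>

lemma Pout_followed:
  assumes "(u, v) \<in> Pout"
  shows "followed B (lexle Q) V \<Longrightarrow> followed B (lexle (tl u @ subst u v Q)) (subst u v V)"
    and "followed A (\<lambda>R. lexle R P) V \<Longrightarrow>
      followed A (\<lambda>R. lexle R (tl u @ subst u v P)) (subst u v V)"
proof -
  have id: "subst [A] [B] w = w" for w
  proof (induction w)
    case (Cons c w)
    then show ?case by (cases c) auto
  qed simp
  have "(followed B (lexle Q) V \<longrightarrow> followed B (lexle (tl u @ subst u v Q)) (subst u v V)) \<and>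
    (followed A (\<lambda>R. lexle R P) V \<longrightarrow>
      followed A (\<lambda>R. lexle R (tl u @ subst u v P)) (subst u v V))"
    using assms
  proof (induction rule: Pout.induct)
    case base
    show ?case by (simp add: id)
  next
    case (phi1 u v)
    obtain x where "u = A # x" using Pout_central_word[OF phi1.hyps] by blast
    then have "tl (phi1 u) @ subst (phi1 u) (phi1 v) w = B # phi1 (tl u @ subst u v w)" for w
      by (simp add: subst_subst)
    then show ?case
      unfolding subst_subst[symmetric, of _ _ u v V]
      using phi1.IH followed_B_phi1[of "tl u @ subst u v Q"] followed_A_phi1[of "tl u @ subst u v P"]
      by metis
  next
    case (phi2 u v)
    obtain x where "u = A # x" using Pout_central_word[OF phi2.hyps] by blast
    then have "tl (phi2 u) @ subst (phi2 u) (phi2 v) w = phi2 (tl u @ subst u v w)" for w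
      by (simp add: subst_subst)
    then show ?case
      unfolding subst_subst[symmetric, of _ _ u v V]
      using phi2.IH followed_B_phi2[of "tl u @ subst u v Q"] followed_A_phi2[of "tl u @ subst u v P"]
      by metis
  qed
  then show "followed B (lexle Q) V \<Longrightarrow> followed B (lexle (tl u @ subst u v Q)) (subst u v V)"
    and "followed A (\<lambda>R. lexle R P) V \<Longrightarrow>
      followed A (\<lambda>R. lexle R (tl u @ subst u v P)) (subst u v V)" by auto
qed

definition word_power :: "'a list \<Rightarrow> nat \<Rightarrow> 'a list" where
  "word_power w n = concat (replicate n w)"

lemma word_power_simps [simp]: "word_power w 0 = []" "word_power w (Suc n) = w @ word_power w n"
  by (simp_all add: word_power_def)

lemma length_word_power [simp]: "length (word_power w n) = n * length w"
  by (induction n) auto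

lemma subst_word_power_AB: "subst u v (word_power [A, B] n) = word_power (u @ v) n"
  by (induction n) auto

lemma lexle_word_power_AB:
  assumes "n \<le> m"
  shows "lexle (word_power [A, B] m) (word_power [A, B] n)" "lexle (word_power [A, B] n @ [B]) (word_power [A, B] m @ [B])"
  using assms
proof (induction n arbitrary: m)
  case 0
  { case 1 show ?case by simp }
  { case 2 show ?case by (cases m) auto }
next
  case (Suc n)
  { case 1 then show ?case using Suc.IH(1) by (cases m) auto }
  { case 2 then show ?case using Suc.IH(2) by (cases m) auto }
qed

lemma followed_word_power_AB:
  assumes "n \<le> m"
  shows "followed B (lexle (word_power [A, B] m)) (word_power [A, B] n)"
    and "followed A (\<lambda>R. lexle R [B]) (word_power [A, B] n)"
    and "followed B (lexle [B]) (word_power [A, B] n @ [B])"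
    and "followed A (\<lambda>R. lexle R (B # word_power [A, B] m @ [B])) (word_power [A, B] n @ [B])"
proof -
  show "followed B (lexle (word_power [A, B] m)) (word_power [A, B] n)"
    using assms by (induction n) (auto simp: lexle_word_power_AB)
  show "followed A (\<lambda>R. lexle R [B]) (word_power [A, B] n)"
    by (induction n) auto
  show "followed B (lexle [B]) (word_power [A, B] n @ [B])"
  proof (induction n)
    case (Suc n)
    then show ?case by (cases n) auto
  qed simp
  show "followed A (\<lambda>R. lexle R (B # word_power [A, B] m @ [B])) (word_power [A, B] n @ [B])"
    using assms by (induction n) (auto simp: lexle_word_power_AB)
qed

text \<open>As \<open>n\<close> grows, bounds (1) and (4) tend to
  \<open>(\<pi>ab)\<^sup>\<omega>\<close> and \<open>(\<pi>ba)\<^sup>\<omega>\<close>; bounds (2)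
  and (3) are the finite word \<pi>b, the source of \<gamma>.\<close>

lemma Pout_followed_word_power:
  assumes "(u, v) \<in> Pout"
  shows "followed B (lexle (tl u @ word_power (u @ v) n)) (word_power (u @ v) n)"
    and "followed A (\<lambda>R. lexle R (tl u @ v)) (word_power (u @ v) n)"
    and "followed B (lexle (tl u @ v)) (word_power (u @ v) n @ v)"
    and "followed A (\<lambda>R. lexle R (tl u @ v @ word_power (u @ v) n @ v)) (word_power (u @ v) n @ v)"
  using Pout_followed(1)[OF assms followed_word_power_AB(1)[OF order_refl, of n]]
    Pout_followed(2)[OF assms followed_word_power_AB(2)[OF order_refl, of n]]
    Pout_followed(1)[OF assms followed_word_power_AB(3)[OF order_refl, of n]]
    Pout_followed(2)[OF assms followed_word_power_AB(4)[OF order_refl, of n]]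
  by (simp_all add: subst_word_power_AB)

section \<open>Values of block words\<close>

fun digit :: "letter \<Rightarrow> nat" where
  "digit A = 2"
| "digit B = 1"

definition block_map :: "letter \<Rightarrow> real \<Rightarrow> real" where
  "block_map c s = 1 / (real (digit c) + 1 / (real (digit c) + s))"

fun word_val :: "letter list \<Rightarrow> real \<Rightarrow> real" where
  "word_val [] s = s"
| "word_val (c # w) s = block_map c (word_val w s)"

lemma block_map_A: "s \<ge> 0 \<Longrightarrow> block_map A s = (2 + s) / (5 + 2 * s)"
  by (simp add: block_map_def field_simps)

lemma block_map_B: "s \<ge> 0 \<Longrightarrow> block_map B s = (1 + s) / (2 + s)"
  by (simp add: block_map_def field_simps)

lemma block_map_A_bounds:
  assumes "0 \<le> s" "s \<le> 1"
  shows "2 / 5 \<le> block_map A s" "block_map A s \<le> 3 / 7"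
  using assms by (auto simp: block_map_A field_simps)

lemma block_map_B_bounds:
  assumes "0 \<le> s" "s \<le> 1"
  shows "1 / 2 \<le> block_map B s" "block_map B s \<le> 2 / 3"
  using assms by (auto simp: block_map_B field_simps)

lemma block_map_bounds:
  assumes "0 \<le> s" "s \<le> 1"
  shows "2 / 5 \<le> block_map c s" "block_map c s \<le> 2 / 3"
  using block_map_A_bounds[OF assms] block_map_B_bounds[OF assms] by (cases c; simp)+

text \<open>The two digits of a block reverse the order twice. Working in blocks thus turns the
  alternating order of continued fractions into a plain lexicographic one.\<close>

lemma block_map_mono:
  assumes "0 \<le> s" "s \<le> t"
  shows "block_map c s \<le> block_map c t"
  using assms by (cases c) (auto simp: block_map_A block_map_B field_simps)

lemma block_map_contraction:
  assumes "0 \<le> s" "0 \<le> t"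
  shows "\<bar>block_map c s - block_map c t\<bar> \<le> \<bar>s - t\<bar> / 4"
proof -
  have "\<exists>D \<ge> 4. block_map c s - block_map c t = (s - t) / D"
  proof (cases c)
    case A
    have "block_map A s - block_map A t = (s - t) / ((5 + 2 * s) * (5 + 2 * t))"
    proof -
      have "5 + 2 * s \<noteq> 0" "5 + 2 * t \<noteq> 0" using assms by linarith+
      then show ?thesis using assms by (simp add: block_map_A field_simps)
    qed
    moreover have "(5 + 2 * s) * (5 + 2 * t) \<ge> 5 * 5"
      using assms by (intro mult_mono) auto
    ultimately show ?thesis using A by (intro exI[of _ "(5 + 2 * s) * (5 + 2 * t)"]) auto
  next
    case B
    have "block_map B s - block_map B t = (s - t) / ((2 + s) * (2 + t))"
    proof -
      have "2 + s \<noteq> 0" "2 + t \<noteq> 0" using assms by linarith+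
      then show ?thesis using assms by (simp add: block_map_B field_simps)
    qed
    moreover have "(2 + s) * (2 + t) \<ge> 2 * 2"
      using assms by (intro mult_mono) auto
    ultimately show ?thesis using B by (intro exI[of _ "(2 + s) * (2 + t)"]) auto
  qed
  then obtain D where D: "D \<ge> 4" "block_map c s - block_map c t = (s - t) / D" by blast
  have "\<bar>block_map c s - block_map c t\<bar> = \<bar>s - t\<bar> / D" using D by simp
  also have "\<dots> \<le> \<bar>s - t\<bar> / 4" using D(1) by (intro divide_left_mono) auto
  finally show ?thesis .
qed

lemma word_val_bounds:
  assumes "0 \<le> s" "s \<le> 1"
  shows "0 \<le> word_val w s" "word_val w s \<le> 1"
proof -
  have "0 \<le> word_val w s \<and> word_val w s \<le> 1"
  proof (induction w)
    case (Cons c w)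
    then show ?case using block_map_bounds[of "word_val w s" c] by simp
  qed (use assms in simp)
  then show "0 \<le> word_val w s" "word_val w s \<le> 1" by auto
qed

lemma word_val_append: "word_val (w @ w') s = word_val w (word_val w' s)"
  by (induction w) auto

text \<open>At the first difference a block b yields at least 1/2 and a block a at most 3/7; an
  ended word yields 0, the least value.\<close>

lemma lexle_imp_word_val_le:
  assumes "lexle xs ys"
  shows "word_val ys 0 \<le> word_val xs 0"
  using assms
proof (induction xs ys rule: lexle.induct)
  case (1 xs)
  show ?case using word_val_bounds[of 0 xs] by simp
next
  case (3 x xs y ys)
  have b: "0 \<le> word_val w 0" "word_val w 0 \<le> 1" for w using word_val_bounds[of 0] by auto
  show ?case
  proof (cases "x = y")
    case True
    then show ?thesis using 3 b by (auto intro: block_map_mono)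
  next
    case False
    then have "x = B" "y = A" using 3 by (cases y; simp)+
    then show ?thesis using block_map_A_bounds[OF b, of ys] block_map_B_bounds[OF b, of xs] by simp
  qed
qed simp

section \<open>Infinite block words and their cuts\<close>

definition block_digits :: "(nat \<Rightarrow> letter) \<Rightarrow> nat \<Rightarrow> nat" where
  "block_digits Z n = digit (Z (n div 2))"

lemma digit_ge_1: "digit c \<ge> 1"
  by (cases c) auto

lemma block_digits_ge_1: "\<forall>n. block_digits Z n \<ge> 1"
  unfolding block_digits_def using digit_ge_1 by blast

lemma suffix_block_digits: "suffix (2 * n) (block_digits Z) = block_digits (suffix n Z)"
  by (simp add: fun_eq_iff block_digits_def)

lemma block_digits_build: "block_digits (c ## Z) = digit c ## digit c ## block_digits Z"
proof
  fix n
  show "block_digits (c ## Z) n = (digit c ## digit c ## block_digits Z) n"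
  proof (cases n)
    case (Suc m)
    then show ?thesis by (cases m) (auto simp: block_digits_def)
  qed (simp add: block_digits_def)
qed

definition omega_val :: "(nat \<Rightarrow> letter) \<Rightarrow> real" where
  "omega_val Z = cfrac (0 ## block_digits Z)"

lemma cfrac_block_digits: "cfrac (block_digits Z) = 1 / omega_val Z"
  using cfrac_0_build[OF block_digits_ge_1, of Z] by (simp add: omega_val_def)

lemma omega_val_bounds: "0 < omega_val Z" "omega_val Z \<le> 1"
  using cfrac_0_build[OF block_digits_ge_1, of Z] cfrac_ge_1[OF block_digits_ge_1, of Z] by (simp_all add: omega_val_def)

lemma omega_val_nonneg: "0 \<le> omega_val Z"
  using omega_val_bounds[of Z] by simp

lemma cfrac_suffix_block_digits:
  "cfrac (suffix (2 * n) (block_digits Z)) = digit (Z n) + 1 / (digit (Z n) + omega_val (suffix (Suc n) Z))"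
  "cfrac (suffix (Suc (2 * n)) (block_digits Z)) = digit (Z n) + omega_val (suffix (Suc n) Z)"
proof -
  have rec: "cfrac (suffix k (block_digits Z)) = block_digits Z k + 1 / cfrac (suffix (Suc k) (block_digits Z))" for k
  proof -
    have "1 \<le> suffix k (block_digits Z) j" for j using block_digits_ge_1[of Z] by simp
    then show ?thesis using cfrac_rec[of "suffix k (block_digits Z)"] by simp
  qed
  have "suffix (Suc (Suc (2 * n))) (block_digits Z) = block_digits (suffix (Suc n) Z)"
    using suffix_block_digits[of "Suc n" Z] by simp
  then show *: "cfrac (suffix (Suc (2 * n)) (block_digits Z)) = digit (Z n) + omega_val (suffix (Suc n) Z)"
    using rec[of "Suc (2 * n)"] by (simp add: cfrac_block_digits block_digits_def)
  show "cfrac (suffix (2 * n) (block_digits Z)) = digit (Z n) + 1 / (digit (Z n) + omega_val (suffix (Suc n) Z))"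
    using rec[of "2 * n"] unfolding * by (simp add: block_digits_def)
qed

lemma omega_val_rec: "omega_val Z = block_map (Z 0) (omega_val (suffix 1 Z))"
proof -
  have "1 / omega_val Z = digit (Z 0) + 1 / (digit (Z 0) + omega_val (suffix (Suc 0) Z))"
    using cfrac_suffix_block_digits(1)[of 0 Z] cfrac_block_digits[of Z] by simp
  then show ?thesis unfolding block_map_def by (metis One_nat_def divide_divide_eq_right div_by_1 mult_1)
qed

lemma omega_val_conc: "omega_val (w \<frown> Z) = word_val w (omega_val Z)"
proof (induction w)
  case (Cons c w)
  have "suffix 1 ((c # w) \<frown> Z) = w \<frown> Z" by (simp add: fun_eq_iff)
  then show ?case using omega_val_rec[of "(c # w) \<frown> Z"] Cons by simp
qed simp

text \<open>Order statements are proved for finite words. Sharing \<open>k\<close> letters brings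
  the values within (1/4)^k, so inequalities pass to infinite words in the limit.\<close>

definition agrees :: "(nat \<Rightarrow> letter) \<Rightarrow> letter list \<Rightarrow> nat \<Rightarrow> bool" where
  "agrees Z w k \<longleftrightarrow> k \<le> length w \<and> take k w = prefix k Z"

lemma agrees_imp_close:
  assumes "agrees Z w k"
  shows "\<bar>omega_val Z - word_val w 0\<bar> \<le> (1 / 4) ^ k"
  using assms
proof (induction k arbitrary: Z w)
  case 0
  show ?case using omega_val_bounds[of Z] word_val_bounds[of 0 w] by simp
next
  case (Suc k)
  then obtain c w' where w: "w = c # w'" by (cases w) (auto simp: agrees_def)
  have p: "prefix (Suc k) Z = Z 0 # prefix k (suffix 1 Z)"
    unfolding subsequence_def by (simp add: upt_rec[of 0 "Suc k"] map_Suc_upt[symmetric] del: upt_Suc)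
  have c: "c = Z 0" "agrees (suffix 1 Z) w' k"
    using Suc.prems p by (auto simp: agrees_def w)
  have "\<bar>omega_val Z - word_val w 0\<bar> \<le> \<bar>omega_val (suffix 1 Z) - word_val w' 0\<bar> / 4"
    unfolding omega_val_rec[of Z] w word_val.simps c(1)
    by (rule block_map_contraction) (use omega_val_nonneg word_val_bounds[of 0] in auto)
  also have "\<dots> \<le> (1 / 4) ^ k / 4" using Suc.IH[of "suffix 1 Z" w'] c(2) by (simp del: suffix_nth)
  finally show ?case by simp
qed

lemma le_if_le_add_geometric:
  fixes a b :: real
  assumes "\<And>k :: nat. a \<le> b + 2 * (1 / 4) ^ k"
  shows "a \<le> b"
proof (rule field_le_epsilon)
  fix e :: real assume "e > 0"
  then obtain k where "(1 / 4 :: real) ^ k < e / 2"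
    using real_arch_pow_inv[of "e / 2" "1 / 4"] by auto
  then show "a \<le> b + e" using assms[of k] by simp
qed

lemma omega_val_le_omega_val:
  assumes "\<And>k. \<exists>a b. agrees Y a k \<and> agrees Z b k \<and> lexle a b"
  shows "omega_val Z \<le> omega_val Y"
proof (rule le_if_le_add_geometric)
  fix k
  obtain a b where ab: "agrees Y a k" "agrees Z b k" "lexle a b" using assms by blast
  show "omega_val Z \<le> omega_val Y + 2 * (1 / 4) ^ k"
    using agrees_imp_close[OF ab(1)] agrees_imp_close[OF ab(2)] lexle_imp_word_val_le[OF ab(3)] by linarith
qed

lemma omega_val_le_word_val:
  assumes "\<And>k. \<exists>b. agrees Z b k \<and> lexle a b"
  shows "omega_val Z \<le> word_val a 0"
proof (rule le_if_le_add_geometric)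
  fix k
  obtain b where b: "agrees Z b k" "lexle a b" using assms by blast
  have "(0 :: real) \<le> (1 / 4) ^ k" by simp
  then show "omega_val Z \<le> word_val a 0 + 2 * (1 / 4) ^ k"
    using agrees_imp_close[OF b(1)] lexle_imp_word_val_le[OF b(2)] by linarith
qed

lemma word_val_le_omega_val:
  assumes "\<And>k. \<exists>a. agrees Y a k \<and> lexle a b"
  shows "word_val b 0 \<le> omega_val Y"
proof (rule le_if_le_add_geometric)
  fix k
  obtain a where a: "agrees Y a k" "lexle a b" using assms by blast
  have "(0 :: real) \<le> (1 / 4) ^ k" by simp
  then show "word_val b 0 \<le> omega_val Y + 2 * (1 / 4) ^ k"
    using agrees_imp_close[OF a(1)] lexle_imp_word_val_le[OF a(2)] by linarith
qed

text \<open>A block \<open>c\<close> contributes two cuts, \<open>cut_val c l r\<close> at its second digit and \<open>cut_val c r l\<close> at its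
  first one, where \<open>l\<close> and \<open>r\<close> are the values of what precedes and follows the block.\<close>

definition cut_val :: "letter \<Rightarrow> real \<Rightarrow> real \<Rightarrow> real" where
  "cut_val c l r = real (digit c) + r + 1 / (real (digit c) + l)"

lemma cut_val_AB:
  assumes "0 \<le> r" "0 \<le> l"
  shows "cut_val A l (block_map B r) = 3 + 1 / (2 + l) - 1 / (2 + r)"
  using assms by (simp add: cut_val_def block_map_B field_simps)

text \<open>Cuts in a block b are at most 1 + 2/3 + 1; those in a block a facing another a, or the
  start of the word (\<open>r = 0\<close>), are at most 2 + 3/7 + 1/2 = 41/14. The constant 293/100
  is a round bound above both.\<close>

lemma cut_val_small:
  assumes "0 \<le> l" and r: "r = 0 \<or> (\<exists>s. 0 \<le> s \<and> s \<le> 1 \<and> r = block_map e s)" and c: "c = B \<or> e = A"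
  shows "cut_val c l r \<le> 293 / 100"
proof -
  have r23: "r \<le> 2 / 3" using r block_map_bounds by auto
  show ?thesis
  proof (cases c)
    case A
    then have "r \<le> 3 / 7" using r c block_map_A_bounds by auto
    moreover have "1 / (2 + l) \<le> 1 / 2" using assms(1) by (intro divide_left_mono) auto
    ultimately show ?thesis using A by (simp add: cut_val_def)
  next
    case B
    have "1 / (1 + l) \<le> 1" using assms(1) by simp
    then show ?thesis using B r23 by (simp add: cut_val_def)
  qed
qed

lemma cut_val_le:
  assumes "0 \<le> l" "0 \<le> s" "s \<le> 1" "293 / 100 \<le> M"
    and "c = A \<Longrightarrow> e = B \<Longrightarrow> 1 / (2 + l) - 1 / (2 + s) \<le> M - 3"
  shows "cut_val c l (block_map e s) \<le> M"
proof (cases "c = A \<and> e = B")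
  case True
  then show ?thesis using assms by (auto simp: cut_val_AB)
next
  case False
  then have "c = B \<or> e = A" by (metis letter.exhaust)
  then have "cut_val c l (block_map e s) \<le> 293 / 100" using assms by (intro cut_val_small) auto
  then show ?thesis using assms by simp
qed

definition left_val :: "(nat \<Rightarrow> letter) \<Rightarrow> nat \<Rightarrow> real" where
  "left_val Z n = word_val (rev (prefix n Z)) 0"

lemma left_val_simps [simp]: "left_val Z 0 = 0" "left_val Z (Suc n) = block_map (Z n) (left_val Z n)"
  by (simp_all add: left_val_def)

lemma left_val_bounds: "0 \<le> left_val Z n" "left_val Z n \<le> 1"
  using word_val_bounds[of 0] by (auto simp: left_val_def)

lemma backward_block_digits:
  "backward (block_digits Z) (2 * n) = left_val Z n"
  "backward (block_digits Z) (Suc (2 * n)) = 1 / (digit (Z n) + left_val Z n)"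
proof -
  show *: "backward (block_digits Z) (2 * n) = left_val Z n"
    by (induction n) (auto simp: block_map_def block_digits_def)
  show "backward (block_digits Z) (Suc (2 * n)) = 1 / (digit (Z n) + left_val Z n)"
    by (simp add: * block_digits_def)
qed

lemma cut_block_digits:
  "cut (block_digits Z) (2 * n) = cut_val (Z n) (omega_val (suffix (Suc n) Z)) (left_val Z n)"
  "cut (block_digits Z) (Suc (2 * n)) = cut_val (Z n) (left_val Z n) (omega_val (suffix (Suc n) Z))"
  unfolding cut_def cfrac_suffix_block_digits backward_block_digits cut_val_def by simp_all

text \<open>Only a cut in an a facing a neighbouring b can exceed 293/100: \<open>AB\<close> has
  that b on the right, \<open>BA\<close> on the left.\<close>

lemma cut_block_digits_le:
  assumes M: "293 / 100 \<le> M"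
    and AB: "\<And>n. Z n = A \<Longrightarrow> Z (Suc n) = B \<Longrightarrow>
      1 / (2 + left_val Z n) - 1 / (2 + omega_val (suffix (Suc (Suc n)) Z)) \<le> M - 3"
    and BA: "\<And>n. Z n = B \<Longrightarrow> Z (Suc n) = A \<Longrightarrow>
      1 / (2 + omega_val (suffix (Suc (Suc n)) Z)) - 1 / (2 + left_val Z n) \<le> M - 3"
  shows "cut (block_digits Z) k \<le> M"
proof -
  have "cut (block_digits Z) (Suc (2 * n)) \<le> M" for n
  proof -
    have "omega_val (suffix (Suc n) Z) = block_map (Z (Suc n)) (omega_val (suffix (Suc (Suc n)) Z))"
      using omega_val_rec[of "suffix (Suc n) Z"] by simp
    then show ?thesis
      unfolding cut_block_digits using M AB omega_val_bounds left_val_bounds by (auto intro!: cut_val_le omega_val_nonneg)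
  qed
  moreover have "cut (block_digits Z) (2 * n) \<le> M" for n
  proof (cases n)
    case 0
    \<comment> \<open>Nothing precedes the first block, so \<open>r = 0\<close>;
      \<open>e = A\<close> just meets the side condition.\<close>
    have "cut_val (Z 0) (omega_val (suffix (Suc 0) Z)) 0 \<le> 293 / 100"
      by (rule cut_val_small[where e = A]) (auto intro: omega_val_nonneg)
    then show ?thesis using M unfolding cut_block_digits 0 by simp
  next
    case (Suc m)
    then show ?thesis
      unfolding cut_block_digits using M BA[of m] omega_val_bounds left_val_bounds by (auto intro!: cut_val_le omega_val_nonneg)
  qed
  ultimately show ?thesis by (metis oddE evenE Suc_eq_plus1)
qed

text \<open>Since \<open>[0; 1, 1] = [0; 2]\<close>, an initial digit \<open>2\<close> acts on later cuts like an initial block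
  \<open>11\<close>.\<close>

lemma backward_2_build: "backward (2 ## block_digits R) (Suc n) = backward (block_digits (B ## R)) (Suc (Suc n))"
  by (induction n) (auto simp: block_digits_build)

lemma cut_2_build: "cut (2 ## block_digits R) (Suc n) = cut (block_digits (B ## R)) (Suc (Suc n))"
proof -
  have "suffix (Suc n) (2 ## block_digits R) = suffix (Suc (Suc n)) (block_digits (B ## R))"
    by (simp add: fun_eq_iff block_digits_build)
  then show ?thesis unfolding cut_def backward_2_build by simp
qed

lemma cut_2_build_0: "cut (2 ## block_digits R) 0 \<le> 293 / 100"
proof -
  have "(2 ## block_digits R) k \<ge> 1" for k using block_digits_ge_1[of R] by (cases k) auto
  then have "cfrac (2 ## block_digits R) = 2 + 1 / cfrac (suffix 1 (2 ## block_digits R))"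
    using cfrac_rec[of "2 ## block_digits R"] by simp
  also have "suffix 1 (2 ## block_digits R) = block_digits R" by (simp add: fun_eq_iff)
  finally have "cfrac (2 ## block_digits R) = 2 + omega_val R" by (simp add: cfrac_block_digits)
  also have "omega_val R \<le> 2 / 3"
    unfolding omega_val_rec[of R] using omega_val_bounds by (intro block_map_bounds omega_val_nonneg)
  finally show ?thesis by (simp add: cut_def)
qed

text \<open>The maximum must lie beyond the initial 11, because only those cuts reappear, with index
  lowered by one, in the word starting with 2.\<close>

lemma mtilde_word_both:
  assumes "293 / 100 \<le> M" "\<And>k. cut (block_digits (B ## R)) k \<le> M" "cut (block_digits (B ## R)) (Suc (Suc k)) = M"
  shows "mtilde_word (block_digits (B ## R)) = ereal M" "mtilde_word (2 ## block_digits R) = ereal M"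
proof -
  show "mtilde_word (block_digits (B ## R)) = ereal M"
    using assms by (intro mtilde_word_eqI[OF block_digits_ge_1]) auto
  have "\<forall>k. (2 ## block_digits R) k \<ge> 1"
  proof
    fix k show "(2 ## block_digits R) k \<ge> 1" using block_digits_ge_1[of R] by (cases k) auto
  qed
  moreover have "cut (2 ## block_digits R) n \<le> M" for n
    using assms(1,2) cut_2_build_0[of R] by (cases n) (auto simp: cut_2_build)
  moreover have "cut (2 ## block_digits R) (Suc k) = M" using assms(3) by (simp add: cut_2_build)
  ultimately show "mtilde_word (2 ## block_digits R) = ereal M"
    using assms(1) by (intro mtilde_word_eqI) auto
qed

section \<open>Periodic words\<close>

lemma iter_unique:
  assumes "w \<noteq> []" "X = w \<frown> X"
  shows "X = w\<^sup>\<omega>"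
proof
  fix n
  show "X n = w\<^sup>\<omega> n"
  proof (induction n rule: less_induct)
    case (less n)
    have u: "w\<^sup>\<omega> = w \<frown> w\<^sup>\<omega>" using assms(1) by (intro iter_unroll) simp
    show ?case
    proof (cases "n < length w")
      case True
      then show ?thesis using fun_cong[OF assms(2), of n] fun_cong[OF u, of n] by simp
    next
      case False
      then have "X (n - length w) = w\<^sup>\<omega> (n - length w)" using assms(1) length_greater_0_conv[of w] by (intro less.IH) linarith
      then show ?thesis
        using False fun_cong[OF assms(2), of n] fun_cong[OF u, of n] by (simp add: conc_snd)
    qed
  qed
qed

lemma iter_conjugate:
  assumes "s @ p = q @ s" "p \<noteq> []"
  shows "s \<frown> p\<^sup>\<omega> = q\<^sup>\<omega>"
proof (rule iter_unique)
  show "q \<noteq> []" using assms by auto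
  have "p\<^sup>\<omega> = p \<frown> p\<^sup>\<omega>" using assms(2) by (intro iter_unroll) simp
  then have "s \<frown> p\<^sup>\<omega> = (s @ p) \<frown> p\<^sup>\<omega>" by (metis conc_conc)
  then show "s \<frown> p\<^sup>\<omega> = q \<frown> s \<frown> p\<^sup>\<omega>" using assms(1) by (metis conc_conc)
qed

lemma word_power_conc_iter: "w \<noteq> [] \<Longrightarrow> word_power w n \<frown> w\<^sup>\<omega> = w\<^sup>\<omega>"
proof (induction n)
  case (Suc n)
  then show ?case by (metis conc_conc iter_unroll length_greater_0_conv word_power_simps(2))
qed simp

lemma digits_conc: "digits w \<frown> block_digits Z = block_digits (w \<frown> Z)"
proof (induction w)
  case (Cons c w)
  then show ?case by (cases c) (auto simp: digits_def block_digits_build conc_conc[symmetric])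
qed (simp add: digits_def)

lemma digits_iter:
  assumes "w \<noteq> []"
  shows "(digits w)\<^sup>\<omega> = block_digits (w\<^sup>\<omega>)"
proof (rule iter_unique[symmetric])
  show "digits w \<noteq> []"
  proof (cases w)
    case (Cons c w')
    then show ?thesis by (cases c) (auto simp: digits_def)
  qed (use assms in simp)
  show "block_digits (w\<^sup>\<omega>) = digits w \<frown> block_digits (w\<^sup>\<omega>)"
    using iter_unroll[of w] assms by (simp add: digits_conc)
qed

lemma length_digits: "length (digits w) = 2 * length w"
proof (induction w)
  case (Cons c w)
  then show ?case by (cases c) (auto simp: digits_def)
qed (simp add: digits_def)

lemma digits_nth:
  assumes "k < 2 * length w"
  shows "digits w ! k = digit (w ! (k div 2))"
proof -
  have "digits w ! k = (digits w \<frown> block_digits (\<lambda>_. A)) k" using assms by (simp add: length_digits)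
  also have "\<dots> = digit (w ! (k div 2))"
    unfolding digits_conc block_digits_def using assms by (simp add: conc_fst)
  finally show ?thesis .
qed

section \<open>Bi-infinite periodic words and finite windows of periodic words\<close>

lemma bi_iter_add: "bi_iter w (i + k * int (length w)) = bi_iter w i"
  by (simp add: bi_iter_def)

lemma bi_iter_nat: "w \<noteq> [] \<Longrightarrow> bi_iter w (int k) = w\<^sup>\<omega> k"
  by (simp add: bi_iter_def nat_mod_as_int)

lemma bi_iter_conjugate:
  assumes "s @ p = q @ s" "p \<noteq> []"
  shows "bi_iter q i = bi_iter p (i - int (length s))"
proof -
  let ?n = "int (length p)"
  have len: "length q = length p" using arg_cong[OF assms(1), of length] by simp
  have q: "q \<noteq> []" using len assms(2) by auto
  have n: "?n \<ge> 1" using assms(2) by (cases p) auto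
  \<comment> \<open>Shifting by \<open>K\<close> whole periods moves the index to at least
    \<open>length s\<close>, where the one-sided \<open>iter_conjugate\<close> applies.\<close>
  define K where "K = int (length s) - i div ?n"
  define j where "j = i + K * ?n"
  have "j = i mod ?n + int (length s) * ?n"
    unfolding j_def K_def using div_mult_mod_eq[of i ?n] by (simp add: algebra_simps)
  moreover have "i mod ?n \<ge> 0" using n by (intro pos_mod_sign) linarith
  moreover have "int (length s) * ?n \<ge> int (length s) * 1" using n by (intro mult_left_mono) auto
  ultimately have js: "j \<ge> int (length s)" by linarith
  have "bi_iter q i = bi_iter q (int (nat j))"
    using js bi_iter_add[of q i K] by (simp add: j_def len)
  also have "\<dots> = (s \<frown> p\<^sup>\<omega>) (nat j)"
    by (simp only: bi_iter_nat[OF q] iter_conjugate[OF assms])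
  also have "\<dots> = p\<^sup>\<omega> (nat j - length s)" using js by (intro conc_snd) linarith
  also have "\<dots> = bi_iter p (int (nat j - length s))" by (simp only: bi_iter_nat[OF assms(2)])
  also have "int (nat j - length s) = (i - int (length s)) + K * ?n" using js by (simp add: j_def)
  also have "bi_iter p \<dots> = bi_iter p (i - int (length s))" by (rule bi_iter_add)
  finally show ?thesis .
qed

lemma bi_iter_rev:
  assumes "w \<noteq> []"
  shows "bi_iter (rev w) i = bi_iter w (- 1 - i)"
proof -
  let ?n = "int (length w)"
  have n: "?n > 0" using assms by simp
  have b: "0 \<le> i mod ?n" "i mod ?n < ?n" using n by auto
  have "- 1 - i = (?n - 1 - i mod ?n) + (- 1 - i div ?n) * ?n"
    using div_mult_mod_eq[of i ?n] by (simp add: algebra_simps)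
  then have "bi_iter w (- 1 - i) = bi_iter w (?n - 1 - i mod ?n)"
    using bi_iter_add[of w] by metis
  also have "\<dots> = w ! nat (?n - 1 - i mod ?n)"
    unfolding bi_iter_def using b by (subst mod_pos_pos_trivial) auto
  also have "nat (?n - 1 - i mod ?n) = length w - Suc (nat (i mod ?n))"
    using b by linarith
  also have "w ! \<dots> = rev w ! nat (i mod ?n)"
    using b by (intro rev_nth[symmetric]) linarith
  finally show ?thesis by (simp add: bi_iter_def)
qed

lemma bi_iter_digits:
  assumes "w \<noteq> []"
  shows "bi_iter (digits w) i = digit (bi_iter w (i div 2))"
proof -
  let ?n = "int (length w)"
  have n: "?n > 0" using assms by simp
  have m: "i mod (2 * ?n) = 2 * (i div 2 mod ?n) + i mod 2"
    by (rule zmod_zmult2_eq) simp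
  have b: "0 \<le> i mod (2 * ?n)" "i mod (2 * ?n) < 2 * ?n" using n by auto
  have "nat (i mod (2 * ?n)) div 2 = nat (i mod (2 * ?n) div 2)"
    using b by (simp add: nat_div_distrib)
  also have "i mod (2 * ?n) div 2 = i div 2 mod ?n" unfolding m by simp
  finally have "digits w ! nat (i mod (2 * ?n)) = digit (w ! nat (i div 2 mod ?n))"
    using b by (subst digits_nth) (linarith, simp)
  then show ?thesis by (simp add: bi_iter_def length_digits)
qed

text \<open>What precedes a position, read backwards, is what follows its letter in the reversed
  prefix; so bounds on continuations also bound histories.\<close>

lemma followed_prefix:
  assumes "followed c P (rev (prefix k Z))" "n < k" "Z n = c"
  shows "P (rev (prefix n Z))"
proof -
  have "prefix k Z = prefix n Z @ Z n # (Z [Suc n \<rightarrow> k])"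
    using subsequence_append[of Z "Suc n" "k - Suc n"] assms(2) by simp
  then have "rev (prefix k Z) = rev (Z [Suc n \<rightarrow> k]) @ c # rev (prefix n Z)"
    using assms(3) by simp
  then show ?thesis using assms(1) unfolding followed_def by blast
qed

lemma word_power_split:
  assumes "w \<noteq> []" "n < m * length w"
  shows "word_power w m = prefix n (w\<^sup>\<omega>) @ w\<^sup>\<omega> n #
    prefix (m * length w - Suc n) (suffix (Suc n) (w\<^sup>\<omega>))"
proof -
  let ?k = "m * length w"
  have "word_power w m = prefix ?k (w\<^sup>\<omega>)"
    using word_power_conc_iter[OF assms(1), of m] prefix_conc_length[of "word_power w m" "w\<^sup>\<omega>"] by simp
  also have "\<dots> = prefix (Suc n) (w\<^sup>\<omega>) @ (w\<^sup>\<omega> [Suc n \<rightarrow> ?k])"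
  proof -
    have "Suc n + (?k - Suc n) = ?k" using assms(2) by simp
    then show ?thesis using subsequence_append[of "w\<^sup>\<omega>" "Suc n" "?k - Suc n"] by argo
  qed
  also have "w\<^sup>\<omega> [Suc n \<rightarrow> ?k] = prefix (?k - Suc n) (suffix (Suc n) (w\<^sup>\<omega>))"
    by (rule subsequence_prefix_suffix[symmetric])
  also have "prefix (Suc n) (w\<^sup>\<omega>) = prefix n (w\<^sup>\<omega>) @ [w\<^sup>\<omega> n]" by (rule subseq_to_Suc) simp
  finally show ?thesis unfolding append_assoc append.simps .
qed

lemma rev_word_power: "rev (word_power w n) = word_power (rev w) n"
  by (simp add: word_power_def rev_concat)

lemma agrees_conc:
  assumes "k \<le> length p"
  shows "agrees (p \<frown> Z) (p @ q) k"
  using assms by (simp add: agrees_def prefix_conc_fst)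

lemma agrees_prefix: "k \<le> n \<Longrightarrow> agrees Z (prefix n Z) k"
  by (simp add: agrees_def subsequence_take)

section \<open>Central words\<close>

lemma word_val_mono:
  assumes "0 \<le> s" "s \<le> t" "t \<le> 1"
  shows "word_val w s \<le> word_val w t"
proof (induction w)
  case (Cons c w)
  then show ?case using assms word_val_bounds[of s w] by (auto intro: block_map_mono)
qed (use assms in simp)

text \<open>The matrices of the two letters are symmetric, so reversing a word transposes its matrix.\<close>

lemma word_val_mobius:
  "\<exists>a b c d. 0 \<le> a \<and> 0 \<le> b \<and> 0 \<le> c \<and> 0 < d \<and>
    (\<forall>s\<ge>0. word_val w s = (a * s + b) / (c * s + d) \<and> word_val (rev w) s = (a * s + c) / (b * s + d))"
proof (induction w)
  case Nil
  show ?case by (rule exI[of _ 1], rule exI[of _ 0], rule exI[of _ 0], rule exI[of _ 1]) simp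
next
  case (Cons e w)
  then obtain a b c d where nn: "0 \<le> a" "0 \<le> b" "0 \<le> c" "0 < d"
    and word_val: "\<And>s. s \<ge> 0 \<Longrightarrow> word_val w s = (a * s + b) / (c * s + d)"
      "\<And>s. s \<ge> 0 \<Longrightarrow> word_val (rev w) s = (a * s + c) / (b * s + d)" by metis
  have pos: "c * s + d > 0" "a * s + b \<ge> 0" "b * s + d > 0" if "s \<ge> 0" for s
    using that nn by (auto simp: add_nonneg_pos)
  define l m :: real where "l = (if e = A then 2 else 1)"
    and "m = (if e = A then 5 else 2)"
  have e: "block_map e s = (s + l) / (l * s + m)" "l * s + m > 0" if "s \<ge> 0" for s
    using that by (cases e; simp add: block_map_A block_map_B l_def m_def add.commute)+
  have lm: "l > 0" "m > 0" by (auto simp: l_def m_def)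
  have 1: "word_val (e # w) s = ((a + l * c) * s + (b + l * d)) / ((l * a + m * c) * s + (l * b + m * d))"
    if "s \<ge> 0" for s
  proof -
    have "word_val (e # w) s = ((a * s + b) / (c * s + d) + l) / (l * ((a * s + b) / (c * s + d)) + m)"
      using e(1)[of "(a * s + b) / (c * s + d)"] pos[OF that] word_val(1)[OF that] by simp
    also have "(a * s + b) / (c * s + d) + l = ((a * s + b) + l * (c * s + d)) / (c * s + d)"
      using pos(1)[OF that] by (simp add: field_simps)
    also have "l * ((a * s + b) / (c * s + d)) + m = (l * (a * s + b) + m * (c * s + d)) / (c * s + d)"
      using pos(1)[OF that] by (simp add: field_simps)
    also have "((a * s + b) + l * (c * s + d)) / (c * s + d) / ((l * (a * s + b) + m * (c * s + d)) / (c * s + d))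
        = ((a * s + b) + l * (c * s + d)) / (l * (a * s + b) + m * (c * s + d))"
      using pos(1)[OF that] by simp
    finally show ?thesis by (simp add: algebra_simps)
  qed
  have 2: "word_val (rev (e # w)) s = ((a + l * c) * s + (l * a + m * c)) / ((b + l * d) * s + (l * b + m * d))"
    if "s \<ge> 0" for s
  proof -
    have as: "block_map e s \<ge> 0" using e[OF that] lm that by simp
    have "word_val (rev (e # w)) s = (a * block_map e s + c) / (b * block_map e s + d)"
      using word_val(2)[OF as] by (simp add: word_val_append)
    also have "a * block_map e s + c = (a * (s + l) + c * (l * s + m)) / (l * s + m)"
      using e[OF that] by (simp add: field_simps)
    also have "b * block_map e s + d = (b * (s + l) + d * (l * s + m)) / (l * s + m)"
      using e[OF that] by (simp add: field_simps)
    also have "(a * (s + l) + c * (l * s + m)) / (l * s + m) / ((b * (s + l) + d * (l * s + m)) / (l * s + m))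
        = (a * (s + l) + c * (l * s + m)) / (b * (s + l) + d * (l * s + m))"
      using e(2)[OF that] by simp
    finally show ?thesis by (simp add: algebra_simps)
  qed
  show ?case
    by (rule exI[of _ "a + l * c"], rule exI[of _ "b + l * d"], rule exI[of _ "l * a + m * c"],
        rule exI[of _ "l * b + m * d"]) (use 1 2 nn lm in \<open>auto intro!: add_nonneg_pos\<close>)
qed

lemma palindrome_word_val_mobius:
  assumes "rev w = w"
  obtains a b d where "0 \<le> a" "0 \<le> b" "0 < d" "\<And>s. s \<ge> 0 \<Longrightarrow> word_val w s = (a * s + b) / (b * s + d)"
proof -
  obtain a b c d where nn: "0 \<le> a" "0 \<le> b" "0 \<le> c" "0 < d"
    and word_val: "\<And>s. s \<ge> 0 \<Longrightarrow> word_val w s = (a * s + b) / (c * s + d)"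
      "\<And>s. s \<ge> 0 \<Longrightarrow> word_val w s = (a * s + c) / (b * s + d)"
    using word_val_mobius[of w] unfolding assms by metis
  \<comment> \<open>At s = 0 the two representations give b/d = c/d, so the matrix is
    symmetric.\<close>
  have "b = c" using word_val[of 0] nn by simp
  then show thesis using that nn word_val by blast
qed

text \<open>With \<open>\<alpha> = 1 / (2 + r)\<close> and \<open>\<beta> = 1 / (2 + l)\<close>, both \<open>\<alpha>\<close> and \<open>3 + \<beta>\<close> are roots of one
  quadratic polynomial, whose coefficients come from the symmetric matrix of \<open>\<pi>\<close>.\<close>

lemma palindrome_midpoint:
  assumes pal: "rev \<pi> = \<pi>"
    and r: "0 \<le> r" "r = word_val \<pi> (block_map A (block_map B r))"
    and l: "0 \<le> l" "l = word_val \<pi> (block_map B (block_map A l))"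
  shows "1 / (2 + r) + 1 / (2 + l) = 2 / (2 + word_val (\<pi> @ [B]) 0)"
proof -
  obtain x y w where nn: "0 \<le> x" "0 \<le> y" "0 < w"
    and word_val: "\<And>s. s \<ge> 0 \<Longrightarrow> word_val \<pi> s = (x * s + y) / (y * s + w)"
    using palindrome_word_val_mobius[OF pal] by metis
  define a b where "a = 1 / (2 + r)" and "b = 1 / (2 + l)"
  have a: "0 < a" "a \<le> 1 / 2" and b: "0 < b" "b \<le> 1 / 2"
    using r l by (auto simp: a_def b_def field_simps)
  have quot: "(x * (p / q) + y) / (y * (p / q) + w) = (x * p + y * q) / (y * p + w * q)"
    if "p > 0" "q > 0" for p q
  proof -
    have "(x * (p / q) + y) = (x * p + y * q) / q" "(y * (p / q) + w) = (y * p + w * q) / q"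
      using that by (simp_all add: add_divide_distrib)
    then show ?thesis using that by simp
  qed
  \<comment> \<open>\<open>K\<close> is the leading coefficient of the quadratic polynomial and, at
    the end, the numerator of 2 plus the value of \<pi>b.\<close>
  define K where "K = x + 4 * y + 4 * w"
  have K: "K > 0" using nn by (simp add: K_def)
  have "block_map A (block_map B r) = (3 - a) / (7 - 2 * a)"
  proof -
    have "block_map B r = 1 - a" using r by (simp add: block_map_B a_def field_simps)
    then show ?thesis using a by (simp add: block_map_A field_simps)
  qed
  then have "r = (x * (3 - a) + y * (7 - 2 * a)) / (y * (3 - a) + w * (7 - 2 * a))"
    using r(2) word_val[of "(3 - a) / (7 - 2 * a)"] quot[of "3 - a" "7 - 2 * a"] a by simp
  moreover have "y * (3 - a) + w * (7 - 2 * a) > 0"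
    using a nn by (intro add_nonneg_pos mult_pos_pos mult_nonneg_nonneg) auto
  ultimately have "r * (y * (3 - a) + w * (7 - 2 * a)) = x * (3 - a) + y * (7 - 2 * a)"
    by (simp add: nonzero_eq_divide_eq)
  then have "(a * r) * (y * (3 - a) + w * (7 - 2 * a)) = a * (x * (3 - a) + y * (7 - 2 * a))"
    by simp
  moreover have "a * r = 1 - 2 * a" using r by (simp add: a_def field_simps)
  ultimately have qa: "K * a\<^sup>2 - a * (3 * x + 14 * y + 16 * w) + (3 * y + 7 * w) = 0"
    by (simp add: K_def algebra_simps power2_eq_square)
  have "block_map B (block_map A l) = (3 + b) / (5 + 2 * b)"
  proof -
    have "block_map A l = 1 / (2 + b)" using l by (simp add: block_map_def b_def)
    moreover have "block_map B (1 / (2 + b)) = (3 + b) / (5 + 2 * b)"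
    proof -
      have "1 + 1 / (2 + b) = (3 + b) / (2 + b)" "2 + 1 / (2 + b) = (5 + 2 * b) / (2 + b)"
        using b by (simp_all add: field_simps)
      then show ?thesis using b by (simp add: block_map_B)
    qed
    ultimately show ?thesis by simp
  qed
  then have "l = (x * (3 + b) + y * (5 + 2 * b)) / (y * (3 + b) + w * (5 + 2 * b))"
    using l(2) word_val[of "(3 + b) / (5 + 2 * b)"] quot[of "3 + b" "5 + 2 * b"] b by simp
  moreover have "y * (3 + b) + w * (5 + 2 * b) > 0"
    using b nn by (intro add_nonneg_pos mult_pos_pos mult_nonneg_nonneg) auto
  ultimately have "l * (y * (3 + b) + w * (5 + 2 * b)) = x * (3 + b) + y * (5 + 2 * b)"
    by (simp add: nonzero_eq_divide_eq)
  then have "(b * l) * (y * (3 + b) + w * (5 + 2 * b)) = b * (x * (3 + b) + y * (5 + 2 * b))"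
    by simp
  moreover have "b * l = 1 - 2 * b" using l by (simp add: b_def field_simps)
  ultimately have qb: "K * (3 + b)\<^sup>2 - (3 + b) * (3 * x + 14 * y + 16 * w) + (3 * y + 7 * w) = 0"
    by (simp add: K_def algebra_simps power2_eq_square)
  \<comment> \<open>Subtracting the equations splits off the difference of the roots, nonzero since
    \<open>a\<close> and \<open>b\<close> lie in (0, 1/2]. What remains is Vieta's formula for the
    sum of the roots.\<close>
  have "(3 + b - a) * (K * (3 + b + a) - (3 * x + 14 * y + 16 * w)) = 0"
    using qa qb by (simp add: algebra_simps power2_eq_square)
  moreover have "3 + b - a \<noteq> 0" using a b by simp
  ultimately have "K * (3 + b + a) - (3 * x + 14 * y + 16 * w) = 0" by (metis mult_eq_0_iff)
  \<comment> \<open>Uses 3 x + 14 y + 16 w - 3 K = 2 (y + 2 w).\<close>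
  then have "K * (a + b) = 2 * (y + 2 * w)"
    by (simp add: K_def algebra_simps)
  then have ab: "a + b = 2 * (y + 2 * w) / K" using K by (simp add: field_simps)
  have "word_val (\<pi> @ [B]) 0 = (x * 1 + y * 2) / (y * 1 + w * 2)"
    using word_val[of "1 / 2"] quot[of 1 2] by (simp add: word_val_append block_map_def)
  then have "2 + word_val (\<pi> @ [B]) 0 = K / (y + 2 * w)"
    using nn by (simp add: K_def field_simps)
  then show ?thesis using ab unfolding a_def b_def by simp
qed

section \<open>The words attached to a fixed pair\<close>

locale central_word =
  fixes u v \<pi> x z :: "letter list"
  assumes Pout: "(u, v) \<in> Pout"
    and pal: "rev \<pi> = \<pi>" and u_eq: "u = A # x" and v_eq: "v = z @ [B]"
    and uv_eq: "u @ v = A # \<pi> @ [B]"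
    and x_eq: "x @ u @ v = \<pi> @ [A, B] @ x" and z_eq: "(u @ v) @ z = z @ [A, B] @ \<pi>"
begin

definition w :: "letter list" where "w = u @ v"
text \<open>In the bi-infinite word, \<open>R1\<close> has the largest value of a continuation after
  b, and \<open>R2\<close> the smallest after a.\<close>

definition R1 :: "nat \<Rightarrow> letter" where "R1 = (\<pi> @ [A, B])\<^sup>\<omega>"
definition R2 :: "nat \<Rightarrow> letter" where "R2 = (\<pi> @ [B, A])\<^sup>\<omega>"
definition tail :: "int \<Rightarrow> nat \<Rightarrow> letter" where "tail i = (\<lambda>k. bi_iter w (i + int k))"
definition ltail :: "int \<Rightarrow> nat \<Rightarrow> letter" where "ltail i = (\<lambda>k. bi_iter w (i - 1 - int k))"

lemma w_eq: "w = A # \<pi> @ [B]" using uv_eq by (simp add: w_def)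
lemma w_ne: "w \<noteq> []" by (simp add: w_eq)
lemma length_w: "length w \<ge> 1" by (simp add: w_eq)
lemma rev_w: "rev w = B # \<pi> @ [A]" by (simp add: w_eq pal)
lemma tl_u: "tl u = x" by (simp add: u_eq)
lemma xv: "x @ v = \<pi> @ [B]" using uv_eq u_eq by simp

lemma R1_eq: "R1 = x \<frown> w\<^sup>\<omega>"
  unfolding R1_def using x_eq w_ne by (intro iter_conjugate[symmetric]) (auto simp: w_def)

lemma R2_eq: "R2 = (x @ v) \<frown> w\<^sup>\<omega>"
  unfolding R2_def using w_ne by (intro iter_conjugate[symmetric]) (auto simp: xv w_eq)

text \<open>As \<pi> is a palindrome, the reversal of uv is b\<pi>a; splitting off the first b
  leaves the period \<pi>ab.\<close>

lemma build_R1: "B ## R1 = (rev w)\<^sup>\<omega>"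
proof -
  have "[B] \<frown> R1 = (rev w)\<^sup>\<omega>"
    unfolding R1_def by (rule iter_conjugate) (auto simp: rev_w)
  then show ?thesis by simp
qed

lemma build_R2: "B ## R2 = rev v \<frown> (rev w)\<^sup>\<omega>"
proof -
  have "rev z @ rev w = (\<pi> @ [B, A]) @ rev z"
    using arg_cong[OF z_eq, of rev] pal by (simp add: w_def)
  then have "rev z \<frown> (rev w)\<^sup>\<omega> = R2"
    unfolding R2_def using w_ne by (intro iter_conjugate) auto
  then show ?thesis by (simp add: v_eq)
qed

lemma R1_nth: "R1 k = bi_iter w (int k - int (length x))"
proof -
  have "R1 k = bi_iter (\<pi> @ [A, B]) (int k)" unfolding R1_def by (rule bi_iter_nat[symmetric]) simp
  also have "\<dots> = bi_iter w (int k - int (length x))"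
    using x_eq w_ne by (intro bi_iter_conjugate) (auto simp: w_def)
  finally show ?thesis .
qed

lemma R2_nth: "R2 k = bi_iter w (int k - int (Suc (length \<pi>)))"
proof -
  have "R2 k = bi_iter (\<pi> @ [B, A]) (int k)" unfolding R2_def by (rule bi_iter_nat[symmetric]) simp
  also have "\<dots> = bi_iter w (int k - int (length (\<pi> @ [B])))"
    using w_ne by (intro bi_iter_conjugate) (auto simp: w_eq)
  finally show ?thesis by simp
qed

lemma omega_val_R1: "omega_val R1 = word_val \<pi> (block_map A (block_map B (omega_val R1)))"
proof -
  have "R1 = (\<pi> @ [A, B]) \<frown> R1" unfolding R1_def by (rule iter_unroll) simp
  then have "omega_val R1 = word_val (\<pi> @ [A, B]) (omega_val R1)" by (metis omega_val_conc)
  then show ?thesis by (simp add: word_val_append)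
qed

lemma omega_val_R2: "omega_val R2 = word_val \<pi> (block_map B (block_map A (omega_val R2)))"
proof -
  have "R2 = (\<pi> @ [B, A]) \<frown> R2" unfolding R2_def by (rule iter_unroll) simp
  then have "omega_val R2 = word_val (\<pi> @ [B, A]) (omega_val R2)" by (metis omega_val_conc)
  then show ?thesis by (simp add: word_val_append)
qed

lemma omega_val_R1_le_R2: "omega_val R1 \<le> omega_val R2"
proof -
  have ab: "0 \<le> block_map c (omega_val Z)" "block_map c (omega_val Z) \<le> 1" for c Z
    using block_map_bounds[OF omega_val_nonneg omega_val_bounds(2), of c Z] by linarith+
  have "block_map A (block_map B (omega_val R1)) \<le> block_map B (block_map A (omega_val R2))"
    using block_map_A_bounds[OF ab, of B R1] block_map_B_bounds[OF ab, of A R2] by linarith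
  moreover have "0 \<le> block_map A (block_map B (omega_val R1))" "block_map B (block_map A (omega_val R2)) \<le> 1"
    using block_map_bounds[OF ab, of A B R1] block_map_bounds[OF ab, of B A R2] by linarith+
  ultimately show ?thesis
    using word_val_mono omega_val_R1 omega_val_R2 by metis
qed

section \<open>Extremal continuations and histories\<close>

lemma tail_eq_suffix:
  obtains n where "bi_iter w i = w\<^sup>\<omega> n" "tail (i + 1) = suffix (Suc n) (w\<^sup>\<omega>)"
proof
  let ?n = "int (length w)" and ?m = "nat (i mod int (length w))"
  have pos: "?n > 0" using w_ne by simp
  have i: "i = int ?m + (i div ?n) * ?n" using pos by simp
  have *: "bi_iter w (i + int k) = w\<^sup>\<omega> (?m + k)" for k
  proof -
    have "i + int k = int (?m + k) + (i div ?n) * ?n" using i by simp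
    then show ?thesis using bi_iter_add[of w "int (?m + k)"] bi_iter_nat[OF w_ne] by metis
  qed
  show "bi_iter w i = w\<^sup>\<omega> ?m" using *[of 0] by simp
  show "tail (i + 1) = suffix (Suc ?m) (w\<^sup>\<omega>)"
  proof
    fix k
    show "tail (i + 1) k = suffix (Suc ?m) (w\<^sup>\<omega>) k"
      using *[of "Suc k"] by (simp add: tail_def algebra_simps del: iter_nth)
  qed
qed

lemma word_power_tail_split:
  assumes "k + Suc n \<le> N"
  shows "word_power w N = prefix n (w\<^sup>\<omega>) @ w\<^sup>\<omega> n # prefix (N * length w - Suc n) (suffix (Suc n) (w\<^sup>\<omega>))"
    and "k \<le> N * length w - Suc n"
proof -
  have "N * 1 \<le> N * length w" using length_w by (intro mult_le_mono) auto
  then show "k \<le> N * length w - Suc n"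
    and "word_power w N = prefix n (w\<^sup>\<omega>) @ w\<^sup>\<omega> n # prefix (N * length w - Suc n) (suffix (Suc n) (w\<^sup>\<omega>))"
    using assms by (linarith, intro word_power_split[OF w_ne], linarith)
qed

lemma le_length_word_power:
  assumes "k \<le> N"
  shows "k \<le> length (p @ word_power w N)"
proof -
  have "N * 1 \<le> N * length w" using length_w by (intro mult_le_mono) auto
  then show ?thesis unfolding length_append length_word_power using assms by linarith
qed

lemma agrees_R1: "k \<le> N \<Longrightarrow> agrees R1 (x @ word_power w N) k"
  using agrees_conc[OF le_length_word_power, of k N x "w\<^sup>\<omega>" "[]"] word_power_conc_iter[OF w_ne, of N]
  by (simp add: R1_eq flip: conc_conc)

lemma agrees_R2: "k \<le> N \<Longrightarrow> agrees R2 (x @ v @ word_power w N @ v) k"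
  using agrees_conc[OF le_length_word_power, of k N "x @ v" "w\<^sup>\<omega>" "v"] word_power_conc_iter[OF w_ne, of N]
  by (simp add: R2_eq flip: conc_conc)

lemmas followed_w = Pout_followed_word_power[OF Pout, folded w_def, unfolded tl_u]

text \<open>Bound (1) holds in every power of \<open>w\<close>. With N = k + n + 1 at least
  \<open>k\<close> letters remain after position \<open>n\<close>, so both finite words agree with
  their limits on \<open>k\<close> letters.\<close>

lemma tail_after_B:
  assumes "bi_iter w i = B"
  shows "omega_val (tail (i + 1)) \<le> omega_val R1"
proof -
  obtain n where n: "bi_iter w i = w\<^sup>\<omega> n" "tail (i + 1) = suffix (Suc n) (w\<^sup>\<omega>)"
    by (rule tail_eq_suffix)
  show ?thesis
  proof (rule omega_val_le_omega_val)
    fix k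
    define N where "N = k + Suc n"
    note s = word_power_tail_split[of k n N]
    let ?b = "prefix (N * length w - Suc n) (suffix (Suc n) (w\<^sup>\<omega>))"
    have "word_power w N = prefix n (w\<^sup>\<omega>) @ B # ?b" using s(1) assms n(1) by (simp only: N_def)
    then have "lexle (x @ word_power w N) ?b" using followed_w(1)[of N] unfolding followed_def by blast
    moreover have "agrees (tail (i + 1)) ?b k"
      unfolding n(2) using s(2) by (intro agrees_prefix) (simp add: N_def)
    moreover have "agrees R1 (x @ word_power w N) k" by (rule agrees_R1) (simp add: N_def)
    ultimately show "\<exists>a b. agrees R1 a k \<and> agrees (tail (i + 1)) b k \<and> lexle a b" by blast
  qed
qed

lemma tail_after_A:
  assumes "bi_iter w i = A"
  shows "omega_val R2 \<le> omega_val (tail (i + 1))"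
proof -
  obtain n where n: "bi_iter w i = w\<^sup>\<omega> n" "tail (i + 1) = suffix (Suc n) (w\<^sup>\<omega>)"
    by (rule tail_eq_suffix)
  show ?thesis
  proof (rule omega_val_le_omega_val)
    fix k
    define N where "N = k + Suc n"
    note s = word_power_tail_split[of k n N]
    let ?b = "prefix (N * length w - Suc n) (suffix (Suc n) (w\<^sup>\<omega>))"
    have "word_power w N = prefix n (w\<^sup>\<omega>) @ A # ?b" using s(1) assms n(1) by (simp only: N_def)
    \<comment> \<open>Bound (4) concerns a power followed by v; this v lies beyond the
      \<open>k\<close> letters that are compared.\<close>
    then have "word_power w N @ v = prefix n (w\<^sup>\<omega>) @ A # (?b @ v)" by simp
    then have "lexle (?b @ v) (x @ v @ word_power w N @ v)"
      using followed_w(4)[of N] unfolding followed_def by blast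
    moreover have "agrees (tail (i + 1)) (?b @ v) k"
    proof -
      have "k \<le> length ?b" using s(2) by (simp add: N_def)
      moreover have "agrees (tail (i + 1)) ?b k"
        unfolding n(2) using s(2) by (intro agrees_prefix) (simp add: N_def)
      ultimately show ?thesis by (simp add: agrees_def)
    qed
    moreover have "agrees R2 (x @ v @ word_power w N @ v) k" by (rule agrees_R2) (simp add: N_def)
    ultimately show "\<exists>a b. agrees (tail (i + 1)) a k \<and> agrees R2 b k \<and> lexle a b" by blast
  qed
qed

lemma followed_build_R1:
  assumes "followed c P (word_power w N)" "n < N" "(B ## R1) n = c"
  shows "P (rev (prefix n (B ## R1)))"
proof (rule followed_prefix)
  have "word_power (rev w) N \<frown> (rev w)\<^sup>\<omega> = (rev w)\<^sup>\<omega>" using w_ne by (intro word_power_conc_iter) simp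
  then have "prefix (N * length w) (B ## R1) = word_power (rev w) N"
    using prefix_conc_length[of "word_power (rev w) N" "(rev w)\<^sup>\<omega>"] by (simp add: build_R1)
  then show "followed c P (rev (prefix (N * length w) (B ## R1)))"
    using assms(1) by (simp add: rev_word_power)
  show "n < N * length w" using assms(2) le_length_word_power[OF order_refl, of N "[]"]
    unfolding append_Nil length_word_power by linarith
qed (rule assms)

lemma followed_build_R2:
  assumes "followed c P (word_power w N @ v)" "n < N" "(B ## R2) n = c"
  shows "P (rev (prefix n (B ## R2)))"
proof (rule followed_prefix)
  have "word_power (rev w) N \<frown> (rev w)\<^sup>\<omega> = (rev w)\<^sup>\<omega>" using w_ne by (intro word_power_conc_iter) simp
  then have "(rev v @ word_power (rev w) N) \<frown> (rev w)\<^sup>\<omega> = B ## R2"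
    unfolding build_R2 by (metis conc_conc)
  then have "prefix (length (rev v @ word_power (rev w) N)) (B ## R2) = rev v @ word_power (rev w) N"
    using prefix_conc_length by metis
  then show "followed c P (rev (prefix (length (rev v @ word_power (rev w) N)) (B ## R2)))"
    using assms(1) by (simp add: rev_word_power)
  show "n < length (rev v @ word_power (rev w) N)" using assms(2) le_length_word_power[OF order_refl, of N "rev v"] by simp
qed (rule assms)

text \<open>Histories are finite, and after an a the bound \<pi>b replaces the two-sided bound
  \<open>R2\<close>. In \<open>B ## R2\<close> it replaces \<open>R1\<close> after a b
  instead.\<close>

lemma left_R1_A: "(B ## R1) n = A \<Longrightarrow> word_val (\<pi> @ [B]) 0 \<le> left_val (B ## R1) n"
  using followed_build_R1[OF followed_w(2), of n "Suc n"] lexle_imp_word_val_le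
  unfolding left_val_def xv by blast

lemma left_R1_B: "(B ## R1) n = B \<Longrightarrow> left_val (B ## R1) n \<le> omega_val R1"
  unfolding left_val_def
proof (rule word_val_le_omega_val)
  fix k assume "(B ## R1) n = B"
  then have "lexle (x @ word_power w (k + Suc n)) (rev (prefix n (B ## R1)))"
    by (intro followed_build_R1[OF followed_w(1)]) auto
  then show "\<exists>a. agrees R1 a k \<and> lexle a (rev (prefix n (B ## R1)))"
    using agrees_R1[of k "k + Suc n"] by auto
qed

lemma left_R2_A: "(B ## R2) n = A \<Longrightarrow> omega_val R2 \<le> left_val (B ## R2) n"
  unfolding left_val_def
proof (rule omega_val_le_word_val)
  fix k assume a: "(B ## R2) n = A"
  have "lexle (rev (prefix n (B ## R2))) (x @ v @ word_power w (k + Suc n) @ v)"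
    by (rule followed_build_R2[OF followed_w(4)]) (use a in auto)
  then show "\<exists>b. agrees R2 b k \<and> lexle (rev (prefix n (B ## R2))) b"
    using agrees_R2[of k "k + Suc n"] by auto
qed

lemma left_R2_B: "(B ## R2) n = B \<Longrightarrow> left_val (B ## R2) n \<le> word_val (\<pi> @ [B]) 0"
  using followed_build_R2[OF followed_w(3), of n "Suc n"] lexle_imp_word_val_le
  unfolding left_val_def xv by blast

section \<open>Approximation constants of the one-sided words\<close>

lemma suffix_build_tail:
  assumes "\<And>k. R k = bi_iter w (int k - e)"
  shows "suffix (Suc (Suc n)) (B ## R) = tail (int n - e + 1)" "(B ## R) (Suc n) = bi_iter w (int n - e)"
  using assms by (auto simp: fun_eq_iff tail_def algebra_simps)

definition mval :: real where "mval = 3 + 1 / (2 + omega_val R2) - 1 / (2 + omega_val R1)"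

lemma recip_mono: "0 \<le> s \<Longrightarrow> s \<le> t \<Longrightarrow> 1 / (2 + t) \<le> 1 / (2 + s)" for s t :: real
  by (intro divide_left_mono) auto

lemma word_val_B_nonneg: "0 \<le> word_val (\<pi> @ [B]) 0"
  by (rule word_val_bounds) auto

lemma midpoint: "1 / (2 + omega_val R1) + 1 / (2 + omega_val R2) = 2 / (2 + word_val (\<pi> @ [B]) 0)"
  by (rule palindrome_midpoint[OF pal omega_val_nonneg omega_val_R1 omega_val_nonneg omega_val_R2])

lemma mval_midpoint:
  "(3 + mval) / 2 = 3 + 1 / (2 + word_val (\<pi> @ [B]) 0) - 1 / (2 + omega_val R1)"
  "(3 + mval) / 2 = 3 + 1 / (2 + omega_val R2) - 1 / (2 + word_val (\<pi> @ [B]) 0)"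
  using midpoint by (auto simp: mval_def)

text \<open>The lower bound makes small cuts irrelevant. The upper bound gives
  \<open>mval \<le> (3 + mval) / 2\<close>, so cuts obeying the two-sided bounds do no harm.\<close>

lemma mval_bounds: "293 / 100 \<le> mval" "mval \<le> 3"
proof -
  have "2 / 5 \<le> omega_val R1" "omega_val R2 \<le> 2 / 3"
    using block_map_bounds[OF omega_val_nonneg omega_val_bounds(2)] omega_val_rec by metis+
  then have "1 / (2 + omega_val R1) \<le> 5 / 12" "3 / 8 \<le> 1 / (2 + omega_val R2)"
    using omega_val_nonneg[of R2] by (auto simp: field_simps)
  then show "293 / 100 \<le> mval" by (simp add: mval_def)
  show "mval \<le> 3" using recip_mono[OF omega_val_nonneg omega_val_R1_le_R2] by (simp add: mval_def)
qed

text \<open>Cuts at ab have a history bounded by \<pi>b and can reach 3 + \<gamma> - \<alpha>; cuts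
  at ba obey the two-sided bounds and are at most \<open>mval\<close>. For \<open>R2\<close> the
  roles are exchanged and the maximum is 3 + \<beta> - \<gamma>.\<close>

lemma mtilde_R1:
  "mtilde_word (block_digits (B ## R1)) = ereal ((3 + mval) / 2)" "mtilde_word (2 ## block_digits R1) = ereal ((3 + mval) / 2)"
proof -
  let ?Z = "B ## R1" and ?M = "(3 + mval) / 2" and ?n = "Suc (length \<pi>)"
  note t = suffix_build_tail[of R1, OF R1_nth]
  have M: "293 / 100 \<le> ?M" using mval_bounds by simp
  have "cut (block_digits ?Z) k \<le> ?M" for k
  proof (rule cut_block_digits_le[OF M])
    fix n assume a: "?Z n = A" "?Z (Suc n) = B"
    have "omega_val (suffix (Suc (Suc n)) ?Z) \<le> omega_val R1"
      unfolding t(1) using a(2) unfolding t(2) by (rule tail_after_B)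
    then show "1 / (2 + left_val ?Z n) - 1 / (2 + omega_val (suffix (Suc (Suc n)) ?Z)) \<le> ?M - 3"
      using recip_mono[OF word_val_B_nonneg left_R1_A[OF a(1)]] recip_mono[OF omega_val_nonneg]
      unfolding mval_midpoint(1) by fastforce
  next
    fix n assume a: "?Z n = B" "?Z (Suc n) = A"
    have "omega_val R2 \<le> omega_val (suffix (Suc (Suc n)) ?Z)"
      unfolding t(1) using a(2) unfolding t(2) by (rule tail_after_A)
    from recip_mono[OF omega_val_nonneg this] recip_mono[OF left_val_bounds(1) left_R1_B[OF a(1)]]
    have "1 / (2 + omega_val (suffix (Suc (Suc n)) ?Z)) - 1 / (2 + left_val ?Z n) \<le> mval - 3"
      by (simp add: mval_def)
    also have "\<dots> \<le> ?M - 3" using mval_bounds by simp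
    finally show "1 / (2 + omega_val (suffix (Suc (Suc n)) ?Z)) - 1 / (2 + left_val ?Z n) \<le> ?M - 3" .
  qed
  \<comment> \<open>The second digit of the a right after the initial b\<pi>: the reversed history
    is \<pi>b, and b followed by \<open>R1\<close> comes next, so both bounds are attained.\<close>
  moreover have "cut (block_digits ?Z) (Suc (Suc (2 * length \<pi> + 1))) = ?M"
  proof -
    have "R1 = (\<pi> @ [A, B]) \<frown> R1" unfolding R1_def by (rule iter_unroll) simp
    then have Z: "?Z = (B # \<pi> @ [A, B]) \<frown> R1" by simp
    have p: "prefix ?n ?Z = B # \<pi>" by (subst Z, subst prefix_conc_fst) auto
    have s: "suffix (Suc ?n) ?Z = [B] \<frown> R1" by (subst Z, subst suffix_conc_fst) auto
    have n: "?Z ?n = A" by (subst Z) (simp add: nth_append del: build_cons build_append)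
    have "cut (block_digits ?Z) (Suc (2 * ?n)) = cut_val A (word_val (\<pi> @ [B]) 0) (block_map B (omega_val R1))"
      unfolding cut_block_digits n s omega_val_conc left_val_def p using pal by simp
    then show ?thesis using mval_midpoint(1) word_val_B_nonneg omega_val_nonneg[of R1] by (simp add: cut_val_AB)
  qed
  ultimately show "mtilde_word (block_digits ?Z) = ereal ?M" "mtilde_word (2 ## block_digits R1) = ereal ?M"
    using mtilde_word_both[OF M] by blast+
qed

lemma mtilde_R2:
  "mtilde_word (block_digits (B ## R2)) = ereal ((3 + mval) / 2)" "mtilde_word (2 ## block_digits R2) = ereal ((3 + mval) / 2)"
proof -
  let ?Z = "B ## R2" and ?M = "(3 + mval) / 2" and ?n = "Suc (length \<pi>)"
  note t = suffix_build_tail[of R2, OF R2_nth]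
  have M: "293 / 100 \<le> ?M" using mval_bounds by simp
  have "cut (block_digits ?Z) k \<le> ?M" for k
  proof (rule cut_block_digits_le[OF M])
    fix n assume a: "?Z n = A" "?Z (Suc n) = B"
    have "omega_val (suffix (Suc (Suc n)) ?Z) \<le> omega_val R1"
      unfolding t(1) using a(2) unfolding t(2) by (rule tail_after_B)
    from recip_mono[OF omega_val_nonneg this] recip_mono[OF omega_val_nonneg left_R2_A[OF a(1)]]
    have "1 / (2 + left_val ?Z n) - 1 / (2 + omega_val (suffix (Suc (Suc n)) ?Z)) \<le> mval - 3"
      by (simp add: mval_def)
    also have "\<dots> \<le> ?M - 3" using mval_bounds by simp
    finally show "1 / (2 + left_val ?Z n) - 1 / (2 + omega_val (suffix (Suc (Suc n)) ?Z)) \<le> ?M - 3" .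
  next
    fix n assume a: "?Z n = B" "?Z (Suc n) = A"
    have "omega_val R2 \<le> omega_val (suffix (Suc (Suc n)) ?Z)"
      unfolding t(1) using a(2) unfolding t(2) by (rule tail_after_A)
    from recip_mono[OF omega_val_nonneg this] recip_mono[OF left_val_bounds(1) left_R2_B[OF a(1)]]
    show "1 / (2 + omega_val (suffix (Suc (Suc n)) ?Z)) - 1 / (2 + left_val ?Z n) \<le> ?M - 3"
      unfolding mval_midpoint(2) by simp
  qed
  \<comment> \<open>The first digit of the a right after the initial b\<pi>b, with \<open>R2\<close>
    to its right and b\<pi>b, read backwards, to its left.\<close>
  moreover have "cut (block_digits ?Z) (Suc (Suc (2 * ?n))) = ?M"
  proof -
    have "R2 = (\<pi> @ [B, A]) \<frown> R2" unfolding R2_def by (rule iter_unroll) simp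
    then have Z: "?Z = (B # \<pi> @ [B, A]) \<frown> R2" by simp
    have p: "prefix (Suc ?n) ?Z = B # \<pi> @ [B]" by (subst Z, subst prefix_conc_fst) auto
    have s: "suffix (Suc (Suc ?n)) ?Z = R2" by (subst Z, subst suffix_conc_fst) auto
    have n: "?Z (Suc ?n) = A" by (subst Z) (simp add: nth_append del: build_cons build_append)
    have "cut (block_digits ?Z) (2 * Suc ?n) = cut_val A (omega_val R2) (block_map B (word_val (\<pi> @ [B]) 0))"
      unfolding cut_block_digits n s left_val_def p using pal by simp
    then show ?thesis using mval_midpoint(2) word_val_B_nonneg omega_val_nonneg[of R2] by (simp add: cut_val_AB)
  qed
  ultimately show "mtilde_word (block_digits ?Z) = ereal ?M" "mtilde_word (2 ## block_digits R2) = ereal ?M"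
    using mtilde_word_both[OF M] by blast+
qed

section \<open>Mirror symmetry and the Markov value\<close>

lemma bi_iter_reflect: "bi_iter w (- 2 - int (length x) - i) = bi_iter w i"
proof -
  let ?j = "i + 1 + int (length x)"
  have "bi_iter w (- 2 - int (length x) - i) = bi_iter (rev w) ?j"
  proof -
    have "- 1 - ?j = - 2 - int (length x) - i" by simp
    then show ?thesis using bi_iter_rev[OF w_ne, of ?j] by argo
  qed
  \<comment> \<open>The reversal b\<pi>a is conjugate to \<pi>ab and hence to \<open>w\<close>; so
    the bi-infinite word is its own mirror image.\<close>
  also have "\<dots> = bi_iter (\<pi> @ [A, B]) (?j - int (length [B]))"
    by (rule bi_iter_conjugate) (auto simp: rev_w)
  also have "\<dots> = bi_iter w (?j - int (length [B]) - int (length x))"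
    using x_eq w_ne by (intro bi_iter_conjugate) (auto simp: w_def)
  finally show ?thesis by simp
qed

text \<open>By symmetry the bounds for right tails carry over to left tails.\<close>

lemma ltail_eq_tail: "ltail j = tail (- 2 - int (length x) - j + 1)"
proof
  fix k
  show "ltail j k = tail (- 2 - int (length x) - j + 1) k"
    using bi_iter_reflect[of "j - 1 - int k"] by (simp add: ltail_def tail_def algebra_simps)
qed

lemma ltail_after_B: "bi_iter w j = B \<Longrightarrow> omega_val (ltail j) \<le> omega_val R1"
  unfolding ltail_eq_tail by (rule tail_after_B) (simp add: bi_iter_reflect)

lemma ltail_after_A: "bi_iter w j = A \<Longrightarrow> omega_val R2 \<le> omega_val (ltail j)"
  unfolding ltail_eq_tail by (rule tail_after_A) (simp add: bi_iter_reflect)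

lemma omega_val_tail_rec: "omega_val (tail j) = block_map (bi_iter w j) (omega_val (tail (j + 1)))"
proof -
  have "suffix 1 (tail j) = tail (j + 1)" by (simp add: fun_eq_iff tail_def algebra_simps)
  then show ?thesis using omega_val_rec[of "tail j"] by (simp add: tail_def)
qed

lemma omega_val_ltail_rec: "omega_val (ltail j) = block_map (bi_iter w (j - 1)) (omega_val (ltail (j - 1)))"
proof -
  have "suffix 1 (ltail j) = ltail (j - 1)" by (simp add: fun_eq_iff ltail_def algebra_simps)
  then show ?thesis using omega_val_rec[of "ltail j"] by (simp add: ltail_def)
qed

definition bicut :: "int \<Rightarrow> real" where
  "bicut i = cfrac (\<lambda>k. bi_iter (digits w) (i + int k))
    + cfrac (0 ## (\<lambda>k. bi_iter (digits w) (i - 1 - int k)))"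

lemma bicut_even: "bicut (2 * j) = cut_val (bi_iter w j) (omega_val (tail (j + 1))) (omega_val (ltail j))"
proof -
  have "(\<lambda>k. bi_iter (digits w) (2 * j + int k)) = block_digits (tail j)"
    by (simp add: fun_eq_iff bi_iter_digits[OF w_ne] block_digits_def tail_def zdiv_int)
  moreover have "(\<lambda>k. bi_iter (digits w) (2 * j - 1 - int k)) = block_digits (ltail j)"
  proof
    fix k
    have "(2 * j - 1 - int k) div 2 = j - 1 - int (k div 2)" by presburger
    then show "bi_iter (digits w) (2 * j - 1 - int k) = block_digits (ltail j) k"
      by (simp add: bi_iter_digits[OF w_ne] block_digits_def ltail_def)
  qed
  moreover have "suffix (Suc 0) (tail j) = tail (j + 1)" "tail j 0 = bi_iter w j"
    by (simp_all add: fun_eq_iff tail_def algebra_simps)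
  ultimately show ?thesis
    using cfrac_suffix_block_digits(1)[of 0 "tail j"] by (simp add: bicut_def cut_val_def omega_val_def)
qed

lemma bicut_odd: "bicut (2 * j + 1) = cut_val (bi_iter w j) (omega_val (ltail j)) (omega_val (tail (j + 1)))"
proof -
  have r: "(\<lambda>k. bi_iter (digits w) (2 * j + 1 + int k)) = suffix (Suc (2 * 0)) (block_digits (tail j))"
  proof
    fix k
    have "(2 * j + 1 + int k) div 2 = j + int (Suc k div 2)" by presburger
    then show "bi_iter (digits w) (2 * j + 1 + int k) = suffix (Suc (2 * 0)) (block_digits (tail j)) k"
      by (simp add: bi_iter_digits[OF w_ne] block_digits_def tail_def)
  qed
  have l: "(\<lambda>k. bi_iter (digits w) (2 * j + 1 - 1 - int k)) = digit (bi_iter w j) ## block_digits (ltail j)"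
  proof
    fix k
    show "bi_iter (digits w) (2 * j + 1 - 1 - int k) = (digit (bi_iter w j) ## block_digits (ltail j)) k"
    proof (cases k)
      case (Suc m)
      have "(2 * j - int (Suc m)) div 2 = j - 1 - int (m div 2)" by presburger
      then show ?thesis using Suc by (simp add: bi_iter_digits[OF w_ne] block_digits_def ltail_def)
    qed (simp add: bi_iter_digits[OF w_ne])
  qed
  have ge: "\<forall>k. (digit (bi_iter w j) ## block_digits (ltail j)) k \<ge> 1"
  proof
    fix k show "(digit (bi_iter w j) ## block_digits (ltail j)) k \<ge> 1"
      using block_digits_ge_1 digit_ge_1[of "bi_iter w j"] by (cases k) auto
  qed
  have "suffix 1 (digit (bi_iter w j) ## block_digits (ltail j)) = block_digits (ltail j)" by (simp add: fun_eq_iff)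
  then have "cfrac (digit (bi_iter w j) ## block_digits (ltail j)) = digit (bi_iter w j) + omega_val (ltail j)"
    using cfrac_rec[of "digit (bi_iter w j) ## block_digits (ltail j)"] ge by (simp add: cfrac_block_digits)
  moreover have "suffix (Suc 0) (tail j) = tail (j + 1)" "tail j 0 = bi_iter w j"
    by (simp_all add: fun_eq_iff tail_def algebra_simps)
  ultimately show ?thesis
    unfolding bicut_def r l cfrac_suffix_block_digits cfrac_0_build[OF ge] by (simp add: cut_val_def)
qed

lemma markov_value_w: "markov_value (bi_iter (digits w)) = ereal mval"
proof -
  have "bicut i \<le> mval" for i
  proof (cases "even i")
    case True
    then obtain j where i: "i = 2 * j" by blast
    show ?thesis
      unfolding i bicut_even omega_val_ltail_rec[of j]
    proof (rule cut_val_le[OF omega_val_nonneg omega_val_nonneg omega_val_bounds(2) mval_bounds(1)])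
      assume "bi_iter w j = A" "bi_iter w (j - 1) = B"
      then show "1 / (2 + omega_val (tail (j + 1))) - 1 / (2 + omega_val (ltail (j - 1))) \<le> mval - 3"
        using recip_mono[OF omega_val_nonneg tail_after_A[of j]] recip_mono[OF omega_val_nonneg ltail_after_B[of "j - 1"]]
        by (simp add: mval_def)
    qed
  next
    case False
    then obtain j where i: "i = 2 * j + 1" by (blast elim: oddE)
    show ?thesis
      unfolding i bicut_odd omega_val_tail_rec[of "j + 1"]
    proof (rule cut_val_le[OF omega_val_nonneg omega_val_nonneg omega_val_bounds(2) mval_bounds(1)])
      assume "bi_iter w j = A" "bi_iter w (j + 1) = B"
      then show "1 / (2 + omega_val (ltail j)) - 1 / (2 + omega_val (tail (j + 1 + 1))) \<le> mval - 3"
        using recip_mono[OF omega_val_nonneg ltail_after_A[of j]] recip_mono[OF omega_val_nonneg tail_after_B[of "j + 1"]]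
        by (simp add: mval_def)
    qed
  qed
  moreover have "bicut (2 * (- 2 - int (length x)) + 1) = mval"
  proof -
    \<comment> \<open>This a and the b after it mirror the first letter of \<open>w\<close> at 0 and
      the last one at -1. The tails beyond them are exactly \<open>R2\<close> and \<open>R1\<close>,
      so both bounds are attained.\<close>
    let ?j = "- 2 - int (length x)"
    have A: "bi_iter w ?j = A"
      using bi_iter_reflect[of 0] by (simp add: bi_iter_def w_eq)
    have B: "bi_iter w (?j + 1) = B"
      using bi_iter_reflect[of "- 1"] bi_iter_rev[OF w_ne, of 0] by (simp add: bi_iter_def rev_w)
    have "tail (?j + 1 + 1) = R1" by (simp add: fun_eq_iff tail_def R1_nth)
    moreover have "ltail ?j = R2"
    proof
      fix k
      have "ltail ?j k = bi_iter w ((int k - int (Suc (length \<pi>))) + 1 * int (length w))"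
        unfolding ltail_eq_tail tail_def by (simp add: w_eq)
      then show "ltail ?j k = R2 k" unfolding bi_iter_add R2_nth .
    qed
    ultimately show ?thesis
      unfolding bicut_odd omega_val_tail_rec[of "?j + 1"] A B by (simp add: cut_val_AB omega_val_nonneg mval_def)
  qed
  ultimately have "(SUP i. ereal (bicut i)) = ereal mval"
    by (intro antisym SUP_least SUP_upper2[of "2 * (- 2 - int (length x)) + 1"]) auto
  then show ?thesis by (simp add: markov_value_def bicut_def)
qed

lemma words:
  "(digits (rev (u @ v)))\<^sup>\<omega> = block_digits (B ## R1)"
  "(2 # digits (tl u)) \<frown> (digits (u @ v))\<^sup>\<omega> = 2 ## block_digits R1"
  "digits (rev v) \<frown> (digits (rev (u @ v)))\<^sup>\<omega> = block_digits (B ## R2)"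
  "(2 # digits (tl u @ v)) \<frown> (digits (u @ v))\<^sup>\<omega> = 2 ## block_digits R2"
proof -
  have r: "rev w \<noteq> []" using w_ne by simp
  show "(digits (rev (u @ v)))\<^sup>\<omega> = block_digits (B ## R1)"
    unfolding w_def[symmetric] digits_iter[OF r] build_R1 ..
  show "digits (rev v) \<frown> (digits (rev (u @ v)))\<^sup>\<omega> = block_digits (B ## R2)"
    unfolding w_def[symmetric] digits_iter[OF r] build_R2 digits_conc ..
  show "(2 # digits (tl u)) \<frown> (digits (u @ v))\<^sup>\<omega> = 2 ## block_digits R1"
    unfolding w_def[symmetric] digits_iter[OF w_ne] tl_u build_cons digits_conc R1_eq ..
  show "(2 # digits (tl u @ v)) \<frown> (digits (u @ v))\<^sup>\<omega> = 2 ## block_digits R2"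
    unfolding w_def[symmetric] digits_iter[OF w_ne] tl_u build_cons digits_conc R2_eq ..
qed

lemma half_sum: "(3 + markov_value (bi_iter (digits (u @ v)))) / 2 = ereal ((3 + mval) / 2)"
proof -
  have "(3 + ereal mval) / 2 = ereal (3 + mval) / ereal 2" by simp
  then show ?thesis using markov_value_w unfolding w_def by simp
qed

end

theorem theorem4p1:
  fixes u v :: "letter list"
  assumes "(u, v) \<in> Pbar"
  shows "mtilde_word ((digits (rev (u @ v)))\<^sup>\<omega>)
           = mtilde_word ((2 # digits (tl u)) \<frown> (digits (u @ v))\<^sup>\<omega>)
       \<and> mtilde_word ((2 # digits (tl u)) \<frown> (digits (u @ v))\<^sup>\<omega>)
           = mtilde_word (digits (rev v) \<frown> (digits (rev (u @ v)))\<^sup>\<omega>)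
       \<and> mtilde_word (digits (rev v) \<frown> (digits (rev (u @ v)))\<^sup>\<omega>)
           = mtilde_word ((2 # digits (tl u @ v)) \<frown> (digits (u @ v))\<^sup>\<omega>)
       \<and> mtilde_word ((2 # digits (tl u @ v)) \<frown> (digits (u @ v))\<^sup>\<omega>)
           = (3 + markov_value (bi_iter (digits (u @ v)))) / 2"
proof -
  have P: "(u, v) \<in> Pout" using assms by (rule Pbar_imp_Pout)
  then obtain \<pi> x z where "rev \<pi> = \<pi>" "u = A # x" "v = z @ [B]" "u @ v = A # \<pi> @ [B]"
    "x @ u @ v = \<pi> @ [A, B] @ x" "(u @ v) @ z = z @ [A, B] @ \<pi>"
    using Pout_central_word by metis
  with P interpret central_word u v \<pi> x z by unfold_locales
  show ?thesis
    unfolding words(3) unfolding words(1,2,4) half_sum mtilde_R1 mtilde_R2 by simp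
qed

end
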